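(* Let $\mathbf{D}$ be a Boolean dagger kernel category. Then $\mathbf{D}_{kck}$, with dagger $(c,k)^\dagger=(k^\dagger,c^\dagger)$, is again a Boolean dagger kernel category, and the functor $D\colon\mathbf{D}_{kck}\to\mathbf{D}$, $X\mapsto X$, $(c,k)\mapsto k\circ c$, is a morphism of dagger kernel categories such that for each object $X$ the induced map from the poset of kernels with codomain $X$ in $\mathbf{D}_{kck}$ to $\mathrm{KSub}(X)$ in $\mathbf{D}$ is an isomorphism (so the induced map of kernel fibrations is a change-of-base/pullback). Moreover, in $\mathbf{D}_{kck}$ the classes of kernels, dagger monos, monos and zero-monos coincide. Finally, $\mathbf{D}_{kck}$ is universal among such categories: for every Boolean dagger kernel category $\mathbf{E}$ in which every zero-mono is a kernel and every morphism of dagger kernel categories $F\colon\mathbf{E}\to\mathbf{D}$, there is a unique functor $G\colon\mathbf{E}\to\mathbf{D}_{kck}$ with $D\circ G=F$.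
   Context: A dagger category is a category with a contravariant functor $\dagger$ that is the identity on objects with $f^{\dagger\dagger}=f$; $f$ is a dagger mono if $f^\dagger\circ f=\mathrm{id}$. A dagger kernel category is a dagger category with a zero object $0$ in which every morphism $f$ has a kernel (universal $k$ with $f\circ k=0$) that can be chosen to be a dagger mono, denoted $\ker(f)$; kernels are represented by dagger monos, and cokernels (morphisms $\mathrm{coker}(f)=\ker(f^\dagger)^\dagger$) by dagger epis. $\mathrm{KSub}(X)$ is the poset of kernels with codomain $X$ modulo isomorphism of domains, ordered by factorisation; meets $\wedge$ are pullbacks. $\mathbf{D}$ is Boolean if for all kernels $m,n$ with common codomain, $m\wedge n=0$ implies $m^\dagger\circ n=0$. A morphism $m$ is a zero-mono if $m\circ f=0$ implies $f=0$. A morphism of dagger kernel categories is a functor $F$ with $F(f^\dagger)=F(f)^\dagger$, sending the zero object to a zero object and a kernel $k$ of $f$ to a kernel of $F(f)$. The category $\mathbf{D}_{kck}$ has the objects of $\mathbf{D}$; a morphism $X\to Y$ is a pair $(c,k)$ of a cokernel $c\colon X\to M$ and a kernel $k\colon M\to Y$ of $\mathbf{D}$, where $(c,k)$ is identified with $(\varphi\circ c,k\circ\varphi^{-1})$ for isomorphisms $\varphi$. The identity is $(\mathrm{id},\mathrm{id})$. The composite of $(c,k)\colon X\to Y$ (via $M$) and $(d,l)\colon Y\to Z$ (via $N$) is $(q^\dagger\circ c,\,l\circ p)$, where $p\colon P\to N$, $q\colon P\to M$ form the pullback $k\circ q=d^\dagger\circ p$ of the kernels $k$ and $d^\dagger$.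 *)

theory Defs
  imports Main
begin

section \<open>Categories and functors\<close>

text \<open>Categories are small, with carrier sets of objects and of arrows. The composite
  \<open>g \<cdot>\<^bsub>C\<^esub> f\<close> is \<open>f\<close> followed by \<open>g\<close>, and is meaningful only if
  the codomain of \<open>f\<close> is the domain of \<open>g\<close>.\<close>

record ('o, 'a) cat =
  Obj :: "'o set"
  Arr :: "'a set"
  Dom :: "'a \<Rightarrow> 'o"
  Cod :: "'a \<Rightarrow> 'o"
  Id :: "'o \<Rightarrow> 'a"
  Comp :: "'a \<Rightarrow> 'a \<Rightarrow> 'a"  (infixr \<open>\<cdot>\<index>\<close> 70)

record ('o, 'a) dagger_cat = "('o, 'a) cat" +
  Dag :: "'a \<Rightarrow> 'a"  (\<open>_\<dagger>\<index>\<close> [1000] 999)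

definition hom :: "('o, 'a, 'm) cat_scheme \<Rightarrow> 'o \<Rightarrow> 'o \<Rightarrow> 'a set" where
  "hom C X Y = {f \<in> Arr C. Dom C f = X \<and> Cod C f = Y}"

locale category =
  fixes C :: "('o, 'a, 'm) cat_scheme" (structure)
  assumes Dom_Obj: "f \<in> Arr C \<Longrightarrow> Dom C f \<in> Obj C"
    and Cod_Obj: "f \<in> Arr C \<Longrightarrow> Cod C f \<in> Obj C"
    and Id_hom: "X \<in> Obj C \<Longrightarrow> Id C X \<in> hom C X X"
    and Comp_hom: "\<lbrakk>f \<in> hom C X Y; g \<in> hom C Y Z\<rbrakk> \<Longrightarrow> g \<cdot> f \<in> hom C X Z"
    and Comp_Id: "f \<in> hom C X Y \<Longrightarrow> f \<cdot> Id C X = f"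
    and Id_Comp: "f \<in> hom C X Y \<Longrightarrow> Id C Y \<cdot> f = f"
    and Comp_assoc: "\<lbrakk>f \<in> hom C X Y; g \<in> hom C Y Z; h \<in> hom C Z W\<rbrakk>
        \<Longrightarrow> (h \<cdot> g) \<cdot> f = h \<cdot> (g \<cdot> f)"

record ('o, 'a, 'p, 'b) fctr =
  FObj :: "'o \<Rightarrow> 'p"
  FArr :: "'a \<Rightarrow> 'b"

definition is_functor ::
  "('o, 'a, 'm) cat_scheme \<Rightarrow> ('p, 'b, 'n) cat_scheme \<Rightarrow> ('o, 'a, 'p, 'b) fctr \<Rightarrow> bool" where
  "is_functor C D F \<longleftrightarrow> category C \<and> category D
    \<and> (\<forall>X \<in> Obj C. FObj F X \<in> Obj D)
    \<and> (\<forall>f \<in> Arr C. FArr F f \<in> hom D (FObj F (Dom C f)) (FObj F (Cod C f)))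
    \<and> (\<forall>X \<in> Obj C. FArr F (Id C X) = Id D (FObj F X))
    \<and> (\<forall>f \<in> Arr C. \<forall>g \<in> Arr C. Dom C g = Cod C f
         \<longrightarrow> FArr F (g \<cdot>\<^bsub>C\<^esub> f) = FArr F g \<cdot>\<^bsub>D\<^esub> FArr F f)"

text \<open>Only the values on the carriers matter.\<close>

definition functor_eq ::
  "('o, 'a, 'm) cat_scheme \<Rightarrow> ('o, 'a, 'p, 'b) fctr \<Rightarrow> ('o, 'a, 'p, 'b) fctr \<Rightarrow> bool" where
  "functor_eq C F G \<longleftrightarrow>
    (\<forall>X \<in> Obj C. FObj F X = FObj G X) \<and> (\<forall>f \<in> Arr C. FArr F f = FArr G f)"

definition functor_comp ::
  "('p, 'b, 'q, 'c) fctr \<Rightarrow> ('o, 'a, 'p, 'b) fctr \<Rightarrow> ('o, 'a, 'q, 'c) fctr" where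
  "functor_comp G F = \<lparr>FObj = FObj G \<circ> FObj F, FArr = FArr G \<circ> FArr F\<rparr>"

text \<open>A strict pullback square of categories: a commuting square of functors whose comparison
  functor into the fibre product of categories is bijective on objects and on arrows.\<close>

definition cat_pullback_square ::
  "('o, 'a, 'm) cat_scheme \<Rightarrow> ('p, 'b, 'n) cat_scheme \<Rightarrow> ('q, 'c, 'k) cat_scheme
    \<Rightarrow> ('r, 'd, 'l) cat_scheme \<Rightarrow> ('o, 'a, 'p, 'b) fctr \<Rightarrow> ('o, 'a, 'q, 'c) fctr
    \<Rightarrow> ('p, 'b, 'r, 'd) fctr \<Rightarrow> ('q, 'c, 'r, 'd) fctr \<Rightarrow> bool" where
  "cat_pullback_square P A B C p q F G \<longleftrightarrow>
    is_functor P A p \<and> is_functor P B q \<and> is_functor A C F \<and> is_functor B C G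
    \<and> functor_eq P (functor_comp F p) (functor_comp G q)
    \<and> bij_betw (\<lambda>x. (FObj p x, FObj q x)) (Obj P)
        {(a, b). a \<in> Obj A \<and> b \<in> Obj B \<and> FObj F a = FObj G b}
    \<and> bij_betw (\<lambda>x. (FArr p x, FArr q x)) (Arr P)
        {(f, g). f \<in> Arr A \<and> g \<in> Arr B \<and> FArr F f = FArr G g}"

section \<open>Notions inside a category\<close>

definition inverse_arrows :: "('o, 'a, 'm) cat_scheme \<Rightarrow> 'a \<Rightarrow> 'a \<Rightarrow> bool" where
  "inverse_arrows C f g \<longleftrightarrow> f \<in> Arr C \<and> g \<in> hom C (Cod C f) (Dom C f)
    \<and> g \<cdot>\<^bsub>C\<^esub> f = Id C (Dom C f) \<and> f \<cdot>\<^bsub>C\<^esub> g = Id C (Cod C f)"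

definition mono_arr :: "('o, 'a, 'm) cat_scheme \<Rightarrow> 'a \<Rightarrow> bool" where
  "mono_arr C m \<longleftrightarrow> m \<in> Arr C
    \<and> (\<forall>X. \<forall>f \<in> hom C X (Dom C m). \<forall>g \<in> hom C X (Dom C m).
         m \<cdot>\<^bsub>C\<^esub> f = m \<cdot>\<^bsub>C\<^esub> g \<longrightarrow> f = g)"

definition zero_object :: "('o, 'a, 'm) cat_scheme \<Rightarrow> 'o \<Rightarrow> bool" where
  "zero_object C Z \<longleftrightarrow> Z \<in> Obj C
    \<and> (\<forall>X \<in> Obj C. (\<exists>!f. f \<in> hom C X Z) \<and> (\<exists>!f. f \<in> hom C Z X))"

definition zero_arr :: "('o, 'a, 'm) cat_scheme \<Rightarrow> 'a \<Rightarrow> bool" where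
  "zero_arr C f \<longleftrightarrow> f \<in> Arr C
    \<and> (\<exists>Z. zero_object C Z
         \<and> (\<exists>g \<in> hom C (Dom C f) Z. \<exists>h \<in> hom C Z (Cod C f). f = h \<cdot>\<^bsub>C\<^esub> g))"

definition zero_mono :: "('o, 'a, 'm) cat_scheme \<Rightarrow> 'a \<Rightarrow> bool" where
  "zero_mono C m \<longleftrightarrow> m \<in> Arr C
    \<and> (\<forall>f \<in> Arr C. Cod C f = Dom C m \<and> zero_arr C (m \<cdot>\<^bsub>C\<^esub> f) \<longrightarrow> zero_arr C f)"

definition kernel_of :: "('o, 'a, 'm) cat_scheme \<Rightarrow> 'a \<Rightarrow> 'a \<Rightarrow> bool" where
  "kernel_of C k f \<longleftrightarrow> f \<in> Arr C \<and> k \<in> Arr C \<and> Cod C k = Dom C f \<and> zero_arr C (f \<cdot>\<^bsub>C\<^esub> k)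
    \<and> (\<forall>g \<in> Arr C. Cod C g = Dom C f \<and> zero_arr C (f \<cdot>\<^bsub>C\<^esub> g)
         \<longrightarrow> (\<exists>!h. h \<in> hom C (Dom C g) (Dom C k) \<and> k \<cdot>\<^bsub>C\<^esub> h = g))"

text \<open>The square \<open>f \<cdot> p = g \<cdot> q\<close> is a pullback.\<close>

definition is_pullback :: "('o, 'a, 'm) cat_scheme \<Rightarrow> 'a \<Rightarrow> 'a \<Rightarrow> 'a \<Rightarrow> 'a \<Rightarrow> bool" where
  "is_pullback C f g p q \<longleftrightarrow> f \<in> Arr C \<and> g \<in> Arr C \<and> Cod C f = Cod C g
    \<and> p \<in> Arr C \<and> q \<in> hom C (Dom C p) (Dom C g) \<and> Cod C p = Dom C f
    \<and> f \<cdot>\<^bsub>C\<^esub> p = g \<cdot>\<^bsub>C\<^esub> q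
    \<and> (\<forall>X. \<forall>a \<in> hom C X (Dom C f). \<forall>b \<in> hom C X (Dom C g). f \<cdot>\<^bsub>C\<^esub> a = g \<cdot>\<^bsub>C\<^esub> b
         \<longrightarrow> (\<exists>!h. h \<in> hom C X (Dom C p) \<and> p \<cdot>\<^bsub>C\<^esub> h = a \<and> q \<cdot>\<^bsub>C\<^esub> h = b))"

section \<open>Dagger kernel categories\<close>

locale dagger_category = category C
  for C :: "('o, 'a, 'm) dagger_cat_scheme" (structure) +
  assumes Dag_hom: "f \<in> hom C X Y \<Longrightarrow> f\<dagger> \<in> hom C Y X"
    and Dag_Id: "X \<in> Obj C \<Longrightarrow> (Id C X)\<dagger> = Id C X"
    and Dag_Comp: "\<lbrakk>f \<in> hom C X Y; g \<in> hom C Y Z\<rbrakk> \<Longrightarrow> (g \<cdot> f)\<dagger> = f\<dagger> \<cdot> g\<dagger>"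
    and Dag_Dag: "f \<in> Arr C \<Longrightarrow> (f\<dagger>)\<dagger> = f"

definition dagger_mono :: "('o, 'a, 'm) dagger_cat_scheme \<Rightarrow> 'a \<Rightarrow> bool" where
  "dagger_mono C f \<longleftrightarrow> f \<in> Arr C \<and> f\<dagger>\<^bsub>C\<^esub> \<cdot>\<^bsub>C\<^esub> f = Id C (Dom C f)"

text \<open>Kernels are always represented by dagger monos, and dually for cokernels.\<close>

definition is_kernel :: "('o, 'a, 'm) dagger_cat_scheme \<Rightarrow> 'a \<Rightarrow> bool" where
  "is_kernel C k \<longleftrightarrow> dagger_mono C k \<and> (\<exists>f. kernel_of C k f)"

definition is_cokernel :: "('o, 'a, 'm) dagger_cat_scheme \<Rightarrow> 'a \<Rightarrow> bool" where
  "is_cokernel C c \<longleftrightarrow> c \<in> Arr C \<and> is_kernel C (c\<dagger>\<^bsub>C\<^esub>)"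

locale dagger_kernel_category = dagger_category C
  for C :: "('o, 'a, 'm) dagger_cat_scheme" (structure) +
  assumes ex_zero_object: "\<exists>Z. zero_object C Z"
    and ex_kernel: "f \<in> Arr C \<Longrightarrow> \<exists>k. kernel_of C k f \<and> dagger_mono C k"

text \<open>The meet of the kernels \<open>m\<close> and \<open>n\<close> is the diagonal \<open>m \<cdot> p\<close> of their pullback. It is the
  bottom of the poset of kernels precisely if it is a zero arrow.\<close>

locale boolean_dagger_kernel_category = dagger_kernel_category C
  for C :: "('o, 'a, 'm) dagger_cat_scheme" (structure) +
  assumes boolean: "\<lbrakk>is_kernel C m; is_kernel C n; Cod C m = Cod C n;
      is_pullback C m n p q; zero_arr C (m \<cdot> p)\<rbrakk> \<Longrightarrow> zero_arr C (m\<dagger> \<cdot> n)"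

definition dagger_kernel_morphism ::
  "('o, 'a, 'm) dagger_cat_scheme \<Rightarrow> ('p, 'b, 'n) dagger_cat_scheme
    \<Rightarrow> ('o, 'a, 'p, 'b) fctr \<Rightarrow> bool" where
  "dagger_kernel_morphism C D F \<longleftrightarrow>
    dagger_kernel_category C \<and> dagger_kernel_category D \<and> is_functor C D F
    \<and> (\<forall>f \<in> Arr C. FArr F (f\<dagger>\<^bsub>C\<^esub>) = (FArr F f)\<dagger>\<^bsub>D\<^esub>)
    \<and> (\<forall>Z. zero_object C Z \<longrightarrow> zero_object D (FObj F Z))
    \<and> (\<forall>f k. kernel_of C k f \<longrightarrow> kernel_of D (FArr F k) (FArr F f))"

section \<open>The poset of kernels and the kernel fibration\<close>

definition ksub_class :: "('o, 'a, 'm) dagger_cat_scheme \<Rightarrow> 'a \<Rightarrow> 'a set" where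
  "ksub_class C m = {n. is_kernel C n \<and>
    (\<exists>\<phi> \<psi>. inverse_arrows C \<phi> \<psi> \<and> \<phi> \<in> hom C (Dom C n) (Dom C m) \<and> n = m \<cdot>\<^bsub>C\<^esub> \<phi>)}"

definition KSub :: "('o, 'a, 'm) dagger_cat_scheme \<Rightarrow> 'o \<Rightarrow> 'a set set" where
  "KSub C X = ksub_class C ` {m. is_kernel C m \<and> Cod C m = X}"

definition ksub_le :: "('o, 'a, 'm) dagger_cat_scheme \<Rightarrow> 'a set \<Rightarrow> 'a set \<Rightarrow> bool" where
  "ksub_le C A B \<longleftrightarrow>
    (\<exists>m \<in> A. \<exists>n \<in> B. \<exists>h \<in> hom C (Dom C m) (Dom C n). m = n \<cdot>\<^bsub>C\<^esub> h)"

text \<open>The map of kernel posets \<open>[m] \<mapsto> [F m]\<close> induced by \<open>F : C \<rightarrow> D\<close>.\<close>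

definition ksub_map ::
  "('p, 'b, 'n) dagger_cat_scheme \<Rightarrow> ('o, 'a, 'p, 'b) fctr \<Rightarrow> 'a set \<Rightarrow> 'b set" where
  "ksub_map D F A = (\<Union>m \<in> A. ksub_class D (FArr F m))"

definition order_iso ::
  "'a set \<Rightarrow> ('a \<Rightarrow> 'a \<Rightarrow> bool) \<Rightarrow> 'b set \<Rightarrow> ('b \<Rightarrow> 'b \<Rightarrow> bool) \<Rightarrow> ('a \<Rightarrow> 'b) \<Rightarrow> bool" where
  "order_iso A le B le' f \<longleftrightarrow>
    bij_betw f A B \<and> (\<forall>x \<in> A. \<forall>y \<in> A. le x y \<longleftrightarrow> le' (f x) (f y))"

text \<open>The total category of the kernel fibration: objects are kernels \<open>[m]\<close> on \<open>X\<close>, and an arrow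
  from \<open>[m]\<close> on \<open>X\<close> to \<open>[n]\<close> on \<open>Y\<close> is an arrow \<open>f : X \<rightarrow> Y\<close> for which \<open>f \<cdot> m\<close> factors
  through \<open>n\<close>. The projection to the base is the fibration.\<close>

definition kernel_fibration ::
  "('o, 'a, 'm) dagger_cat_scheme
    \<Rightarrow> ('o \<times> 'a set, ('o \<times> 'a set) \<times> 'a \<times> ('o \<times> 'a set)) cat" where
  "kernel_fibration C = \<lparr>
    Obj = {(X, A). X \<in> Obj C \<and> A \<in> KSub C X},
    Arr = {((X, A), f, (Y, B)). A \<in> KSub C X \<and> B \<in> KSub C Y \<and> f \<in> hom C X Y
      \<and> (\<exists>m \<in> A. \<exists>n \<in> B. \<exists>h \<in> hom C (Dom C m) (Dom C n). f \<cdot>\<^bsub>C\<^esub> m = n \<cdot>\<^bsub>C\<^esub> h)},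
    Dom = (\<lambda>(a, f, b). a),
    Cod = (\<lambda>(a, f, b). b),
    Id = (\<lambda>a. (a, Id C (fst a), a)),
    Comp = (\<lambda>(b, g, c) (a, f, b'). (a, g \<cdot>\<^bsub>C\<^esub> f, c))\<rparr>"

definition kernel_fibration_proj ::
  "('o \<times> 'a set, ('o \<times> 'a set) \<times> 'a \<times> ('o \<times> 'a set), 'o, 'a) fctr" where
  "kernel_fibration_proj = \<lparr>FObj = fst, FArr = (\<lambda>(a, f, b). f)\<rparr>"

definition kernel_fibration_map ::
  "('p, 'b, 'n) dagger_cat_scheme \<Rightarrow> ('o, 'a, 'p, 'b) fctr
    \<Rightarrow> ('o \<times> 'a set, ('o \<times> 'a set) \<times> 'a \<times> ('o \<times> 'a set),
        'p \<times> 'b set, ('p \<times> 'b set) \<times> 'b \<times> ('p \<times> 'b set)) fctr" where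
  "kernel_fibration_map D F =
    (let obj = (\<lambda>(X, A). (FObj F X, ksub_map D F A))
     in \<lparr>FObj = obj, FArr = (\<lambda>(a, f, b). (obj a, FArr F f, obj b))\<rparr>)"

section \<open>The category of cokernel-kernel pairs\<close>

definition kck_pair :: "('o, 'a, 'm) dagger_cat_scheme \<Rightarrow> 'a \<Rightarrow> 'a \<Rightarrow> bool" where
  "kck_pair C c k \<longleftrightarrow> is_cokernel C c \<and> is_kernel C k \<and> Cod C c = Dom C k"

definition kck_class :: "('o, 'a, 'm) dagger_cat_scheme \<Rightarrow> 'a \<Rightarrow> 'a \<Rightarrow> ('a \<times> 'a) set" where
  "kck_class C c k = {(c', k'). kck_pair C c' k' \<and>
    (\<exists>\<phi> \<psi>. inverse_arrows C \<phi> \<psi> \<and> Dom C \<phi> = Cod C c \<and> c' = \<phi> \<cdot>\<^bsub>C\<^esub> c \<and> k' = k \<cdot>\<^bsub>C\<^esub> \<psi>)}"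

text \<open>Arrows are equivalence classes of pairs. Domain and codomain are those common to all
  representatives. The composite collects the classes obtained from all choices of
  representatives and of pullback; these classes are equal. The legs \<open>p\<close>, \<open>q\<close> are required to be
  kernels, hence dagger mono: for an arbitrary representative of the pullback, \<open>q\<dagger> \<cdot> c\<close> need
  not be dagger epi.\<close>

definition kck :: "('o, 'a, 'm) dagger_cat_scheme \<Rightarrow> ('o, ('a \<times> 'a) set) dagger_cat" where
  "kck C = \<lparr>
    Obj = Obj C,
    Arr = {kck_class C c k | c k. kck_pair C c k},
    Dom = (\<lambda>S. the_elem ((\<lambda>(c, k). Dom C c) ` S)),
    Cod = (\<lambda>S. the_elem ((\<lambda>(c, k). Cod C k) ` S)),
    Id = (\<lambda>X. kck_class C (Id C X) (Id C X)),
    Comp = (\<lambda>T S. \<Union>{kck_class C (q\<dagger>\<^bsub>C\<^esub> \<cdot>\<^bsub>C\<^esub> c) (l \<cdot>\<^bsub>C\<^esub> p) | c k d l p q.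
      (c, k) \<in> S \<and> (d, l) \<in> T \<and> is_pullback C k (d\<dagger>\<^bsub>C\<^esub>) q p \<and> is_kernel C p \<and> is_kernel C q}),
    Dag = (\<lambda>S. (\<lambda>(c, k). (k\<dagger>\<^bsub>C\<^esub>, c\<dagger>\<^bsub>C\<^esub>)) ` S)\<rparr>"

definition kck_functor ::
  "('o, 'a, 'm) dagger_cat_scheme \<Rightarrow> ('o, ('a \<times> 'a) set, 'o, 'a) fctr" where
  "kck_functor C = \<lparr>
    FObj = (\<lambda>X. X),
    FArr = (\<lambda>S. the_elem ((\<lambda>(c, k). k \<cdot>\<^bsub>C\<^esub> c) ` S))\<rparr>"

end

theory Submission
  imports Defs
begin

text \<open>Write \<open>k \<cdot> c\<close> for the arrow of the base underlying a pair \<open>(c, k)\<close>. Since \<open>c\<close> is dagger epi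
  and \<open>k\<close> dagger mono, an arrow has at most one such factorisation up to isomorphism, so the
  category of pairs is a wide subcategory of the base. Closure under composition is where
  Booleanness enters: for kernels \<open>m\<close>, \<open>n\<close> with pullback \<open>m \<cdot> p = n \<cdot> q\<close> one has
  \<open>m\<dagger> \<cdot> n = p \<cdot> q\<dagger>\<close>. The subcategory contains all kernels, cokernels and zero arrows, hence
  inherits kernels, Booleanness and the posets of kernels. A zero-mono \<open>k \<cdot> c\<close> has a unitary \<open>c\<close>,
  so it is a kernel. If all zero-monos of a dagger kernel category are kernels, then every arrow
  \<open>f\<close> has the form \<open>k \<cdot> c\<close>, with \<open>c\<close> the coimage of \<open>f\<close>; a morphism of dagger kernel categories
  preserves this factorisation and therefore lands in the subcategory.\<close>

section \<open>Zero arrows and kernels\<close>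

text \<open>Why composition calls for Booleanness: if unit vectors \<open>m\<close> and
  \<open>n\<close> span distinct, non-orthogonal lines of a Hilbert space, then
  \<open>m\<dagger> \<cdot> n\<close> is a nonzero scalar although the pullback is zero, so
  composing pairs would disagree with composing in the base. A second obstacle is that a universal
  property in \<open>kck C\<close> is tested only on pairs; it is bridged by comparison with a base
  kernel, which is itself a pair. Throughout, universal properties are traded for equations. The
  only possible factor of \<open>g\<close> through a dagger mono \<open>k\<close> is
  \<open>k\<dagger> \<cdot> g\<close>, so factoring through \<open>k\<close> means
  \<open>k \<cdot> (k\<dagger> \<cdot> g) = g\<close>. A kernel is the complement of its complement,
  so this amounts to \<open>(perp C k)\<dagger> \<cdot> g\<close> being zero. The projection
  \<open>m \<cdot> m\<dagger>\<close> identifies a kernel up to isomorphism, just as the composite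
  identifies a class of pairs.\<close>

context category
begin

lemmas [simp] = Dom_Obj Cod_Obj

lemma Id_simps [simp]:
  assumes "X \<in> Obj C"
  shows "Id C X \<in> Arr C" "Dom C (Id C X) = X" "Cod C (Id C X) = X"
  using Id_hom[OF assms] by (auto simp: hom_def)

lemma Comp_simps [simp]:
  assumes "f \<in> Arr C" "g \<in> Arr C" "Dom C g = Cod C f"
  shows "g \<cdot> f \<in> Arr C" "Dom C (g \<cdot> f) = Dom C f" "Cod C (g \<cdot> f) = Cod C g"
  using Comp_hom[of f "Dom C f" "Cod C f" g "Cod C g"] assms by (auto simp: hom_def)

lemma Comp_Id_left [simp]: "f \<in> Arr C \<Longrightarrow> X = Cod C f \<Longrightarrow> Id C X \<cdot> f = f"
  and Comp_Id_right [simp]: "f \<in> Arr C \<Longrightarrow> X = Dom C f \<Longrightarrow> f \<cdot> Id C X = f"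
  using Id_Comp Comp_Id by (auto simp: hom_def)

lemma assoc [simp]:
  assumes "f \<in> Arr C" "g \<in> Arr C" "h \<in> Arr C" "Dom C g = Cod C f" "Dom C h = Cod C g"
  shows "(h \<cdot> g) \<cdot> f = h \<cdot> (g \<cdot> f)"
  using assms Comp_assoc by (auto simp: hom_def)

lemma zero_arr_Arr: "zero_arr C f \<Longrightarrow> f \<in> Arr C"
  by (simp add: zero_arr_def)

lemma zero_arrE:
  assumes "zero_arr C f"
  obtains Z a b where "zero_object C Z" "f \<in> Arr C" "a \<in> Arr C" "Dom C a = Dom C f" "Cod C a = Z"
    "b \<in> Arr C" "Dom C b = Z" "Cod C b = Cod C f" "b \<cdot> a = f"
  using assms unfolding zero_arr_def hom_def by blast

lemma zero_arrI:
  assumes "zero_object C Z" "a \<in> Arr C" "Cod C a = Z" "b \<in> Arr C" "Dom C b = Z"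
  shows "zero_arr C (b \<cdot> a)"
  unfolding zero_arr_def using assms
  by (intro conjI exI[of _ Z] bexI[of _ a] bexI[of _ b]) (auto simp: hom_def)

lemma zero_arr_comp_left:
  assumes "zero_arr C f" "g \<in> Arr C" "Dom C g = Cod C f"
  shows "zero_arr C (g \<cdot> f)"
  using assms(1)
proof (rule zero_arrE)
  fix Z a b
  assume Z: "zero_object C Z" "f \<in> Arr C" "a \<in> Arr C" "Dom C a = Dom C f" "Cod C a = Z"
    "b \<in> Arr C" "Dom C b = Z" "Cod C b = Cod C f" "b \<cdot> a = f"
  then have "zero_arr C ((g \<cdot> b) \<cdot> a)"
    using assms by (intro zero_arrI) auto
  then show ?thesis
    using Z assms by simp
qed

lemma zero_arr_comp_right:
  assumes "zero_arr C f" "g \<in> Arr C" "Dom C f = Cod C g"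
  shows "zero_arr C (f \<cdot> g)"
  using assms(1)
proof (rule zero_arrE)
  fix Z a b
  assume Z: "zero_object C Z" "f \<in> Arr C" "a \<in> Arr C" "Dom C a = Dom C f" "Cod C a = Z"
    "b \<in> Arr C" "Dom C b = Z" "Cod C b = Cod C f" "b \<cdot> a = f"
  then have "zero_arr C (b \<cdot> (a \<cdot> g))"
    using assms by (intro zero_arrI) auto
  also have "b \<cdot> (a \<cdot> g) = (b \<cdot> a) \<cdot> g"
    using Z assms by (intro assoc[symmetric]) auto
  finally show ?thesis
    using Z(9) by simp
qed

text \<open>The two arrows may pass through different zero objects; an arrow \<open>t\<close>
  between these objects identifies the two factorisations.\<close>

lemma zero_arr_unique:
  assumes "zero_arr C f" "zero_arr C g" "Dom C f = Dom C g" "Cod C f = Cod C g"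
  shows "f = g"
  using assms(1)
proof (rule zero_arrE)
  fix Z a b
  assume Z: "zero_object C Z" "f \<in> Arr C" "a \<in> Arr C" "Dom C a = Dom C f" "Cod C a = Z"
    "b \<in> Arr C" "Dom C b = Z" "Cod C b = Cod C f" "b \<cdot> a = f"
  obtain W a' b' where W: "zero_object C W" "a' \<in> Arr C" "Dom C a' = Dom C g" "Cod C a' = W"
      "b' \<in> Arr C" "Dom C b' = W" "Cod C b' = Cod C g" "b' \<cdot> a' = g"
    using assms(2) by (rule zero_arrE)
  obtain t where t: "t \<in> Arr C" "Dom C t = Z" "Cod C t = W"
    using Z(1) W(1) unfolding zero_object_def hom_def by blast
  have X: "Dom C f \<in> Obj C" "Cod C f \<in> Obj C"
    using Z by auto
  have "t \<cdot> a \<in> hom C (Dom C f) W" "b' \<cdot> t \<in> hom C Z (Cod C f)"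
      "a' \<in> hom C (Dom C f) W" "b \<in> hom C Z (Cod C f)"
    using t Z W assms by (simp_all add: hom_def)
  then have *: "t \<cdot> a = a'" "b' \<cdot> t = b"
    using Z(1) W(1) X unfolding zero_object_def by blast+
  have "(b' \<cdot> t) \<cdot> a = b' \<cdot> (t \<cdot> a)"
    using t Z W assms by (intro assoc) auto
  then show ?thesis
    unfolding * using Z(9) W(8) by simp
qed

lemma zero_arr_to_zero_object:
  assumes "zero_object C Z" "f \<in> Arr C" "Cod C f = Z"
  shows "zero_arr C f"
  unfolding zero_arr_def using assms Id_hom[of Z]
  by (intro conjI exI[of _ Z] bexI[of _ f] bexI[of _ "Id C Z"]) (auto simp: hom_def)

lemma zero_arr_from_zero_object:
  assumes "zero_object C Z" "f \<in> Arr C" "Dom C f = Z"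
  shows "zero_arr C f"
  unfolding zero_arr_def using assms Id_hom[of Z]
  by (intro conjI exI[of _ Z] bexI[of _ f] bexI[of _ "Id C Z"]) (auto simp: hom_def)

lemma zero_object_homE:
  assumes "zero_object C Z" "X \<in> Obj C"
  obtains a b where "a \<in> hom C X Z" "b \<in> hom C Z X"
  using assms unfolding zero_object_def by blast

text \<open>Every arrow into or out of \<open>Z\<close> is its own composite with the zero arrow
  \<open>Id C Z\<close>, so parallel ones agree. Existence is borrowed from the zero object
  \<open>W\<close> through which the identity passes.\<close>

lemma zero_objectI:
  assumes "zero_arr C (Id C Z)" "Z \<in> Obj C"
  shows "zero_object C Z"
proof -
  obtain W a b where W: "zero_object C W" "a \<in> hom C Z W" "b \<in> hom C W Z"
    using assms by (auto elim!: zero_arrE simp: hom_def)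
  have *: "zero_arr C f" if "f \<in> Arr C" "Cod C f = Z \<or> Dom C f = Z" for f
    using zero_arr_comp_left[of "Id C Z" f] zero_arr_comp_right[of "Id C Z" f] assms that by auto
  have "(\<exists>!f. f \<in> hom C X Z) \<and> (\<exists>!f. f \<in> hom C Z X)" if X: "X \<in> Obj C" for X
  proof -
    obtain u v where "u \<in> hom C X W" "v \<in> hom C W X"
      using zero_object_homE[OF W(1) X] .
    then have "b \<cdot> u \<in> hom C X Z" "v \<cdot> a \<in> hom C Z X"
      using W by (auto simp: hom_def)
    moreover have "f = g" if "f \<in> hom C X Z" "g \<in> hom C X Z" for f g
      using that *[of f] *[of g] zero_arr_unique[of f g] by (auto simp: hom_def)
    moreover have "f = g" if "f \<in> hom C Z X" "g \<in> hom C Z X" for f g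
      using that *[of f] *[of g] zero_arr_unique[of f g] by (auto simp: hom_def)
    ultimately show ?thesis by blast
  qed
  then show ?thesis
    using assms(2) by (auto simp: zero_object_def)
qed

end

section \<open>Dagger monos, and kernels expressed by equations\<close>

context dagger_category
begin

lemma Dag_simps [simp]:
  assumes "f \<in> Arr C"
  shows "f\<dagger> \<in> Arr C" "Dom C (f\<dagger>) = Cod C f" "Cod C (f\<dagger>) = Dom C f" "(f\<dagger>)\<dagger> = f"
  using Dag_hom[of f "Dom C f" "Cod C f"] Dag_Dag assms by (auto simp: hom_def)

lemma Dag_Comp_simp [simp]:
  assumes "f \<in> Arr C" "g \<in> Arr C" "Dom C g = Cod C f"
  shows "(g \<cdot> f)\<dagger> = f\<dagger> \<cdot> g\<dagger>"
  using Dag_Comp assms by (auto simp: hom_def)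

lemmas [simp] = Dag_Id

lemma zero_arr_Dag:
  assumes "zero_arr C f"
  shows "zero_arr C (f\<dagger>)"
  using assms
proof (rule zero_arrE)
  fix Z a b
  assume Z: "zero_object C Z" "f \<in> Arr C" "a \<in> Arr C" "Dom C a = Dom C f" "Cod C a = Z"
    "b \<in> Arr C" "Dom C b = Z" "Cod C b = Cod C f" "b \<cdot> a = f"
  then have "zero_arr C (a\<dagger> \<cdot> b\<dagger>)"
    by (intro zero_arrI) auto
  also have "a\<dagger> \<cdot> b\<dagger> = (b \<cdot> a)\<dagger>"
    using Z by (intro Dag_Comp_simp[symmetric]) auto
  finally show ?thesis
    using Z(9) by simp
qed

lemma dagger_mono_Arr: "dagger_mono C k \<Longrightarrow> k \<in> Arr C"
  by (simp add: dagger_mono_def)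

text \<open>The second rule is the form that \<open>simp\<close> meets: \<open>assoc\<close> nests
  composites to the right, which hides the subterm \<open>k\<dagger> \<cdot> k\<close>.\<close>

lemma dagger_mono_simps [simp]:
  assumes "dagger_mono C k"
  shows "k\<dagger> \<cdot> k = Id C (Dom C k)"
    and "x \<in> Arr C \<Longrightarrow> Cod C x = Dom C k \<Longrightarrow> k\<dagger> \<cdot> (k \<cdot> x) = x"
proof -
  show *: "k\<dagger> \<cdot> k = Id C (Dom C k)"
    using assms by (simp add: dagger_mono_def)
  have k: "k \<in> Arr C"
    using assms by (simp add: dagger_mono_def)
  show "k\<dagger> \<cdot> (k \<cdot> x) = x" if "x \<in> Arr C" "Cod C x = Dom C k"
    using that assoc[of x k "k\<dagger>"] k by (simp add: *)
qed

lemma dagger_mono_cancel: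
  assumes "dagger_mono C k" "a \<in> Arr C" "b \<in> Arr C" "Cod C a = Dom C k" "Cod C b = Dom C k"
    and "k \<cdot> a = k \<cdot> b"
  shows "a = b"
  using dagger_mono_simps(2)[OF assms(1)] assms(2-) by metis

lemma dagger_mono_Comp:
  assumes "dagger_mono C m" "dagger_mono C p" "Cod C p = Dom C m"
  shows "dagger_mono C (m \<cdot> p)"
  using assms dagger_mono_Arr[OF assms(1)] dagger_mono_Arr[OF assms(2)]
  by (simp add: dagger_mono_def[of C "m \<cdot> p"])

text \<open>Cancelling with \<open>k\<dagger>\<close> shows that the factor can only be
  \<open>k\<dagger> \<cdot> g\<close>, so the existential in the universal property becomes an
  equation. \<open>kernel_ofI\<close> is the converse.\<close>

lemma kernel_of_factor:
  assumes "kernel_of C k f" "dagger_mono C k" "g \<in> Arr C" "Cod C g = Dom C f" "zero_arr C (f \<cdot> g)"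
  shows "k \<cdot> (k\<dagger> \<cdot> g) = g"
proof -
  obtain h where "h \<in> hom C (Dom C g) (Dom C k)" "k \<cdot> h = g"
    using assms unfolding kernel_of_def by blast
  then show ?thesis
    using assms(2) by (auto simp: hom_def)
qed

lemma kernel_ofI:
  assumes "dagger_mono C k" "f \<in> Arr C" "Cod C k = Dom C f" "zero_arr C (f \<cdot> k)"
    and *: "\<And>g. \<lbrakk>g \<in> Arr C; Cod C g = Dom C f; zero_arr C (f \<cdot> g)\<rbrakk> \<Longrightarrow> k \<cdot> (k\<dagger> \<cdot> g) = g"
  shows "kernel_of C k f"
proof -
  have k: "k \<in> Arr C"
    using assms(1) by (simp add: dagger_mono_def)
  have "\<exists>!h. h \<in> hom C (Dom C g) (Dom C k) \<and> k \<cdot> h = g"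
    if g: "g \<in> Arr C" "Cod C g = Dom C f" "zero_arr C (f \<cdot> g)" for g
  proof (rule ex1I)
    show "k\<dagger> \<cdot> g \<in> hom C (Dom C g) (Dom C k) \<and> k \<cdot> (k\<dagger> \<cdot> g) = g"
      using *[OF g] g k assms by (simp add: hom_def)
    show "h = k\<dagger> \<cdot> g" if "h \<in> hom C (Dom C g) (Dom C k) \<and> k \<cdot> h = g" for h
      using that assms(1) by (auto simp: hom_def)
  qed
  then show ?thesis
    using assms k by (auto simp: kernel_of_def)
qed

lemma kernel_ofD:
  assumes "kernel_of C k f"
  shows "f \<in> Arr C" "k \<in> Arr C" "Cod C k = Dom C f" "zero_arr C (f \<cdot> k)"
  using assms unfolding kernel_of_def by blast+

lemma kernel_of_is_kernel: "kernel_of C k f \<Longrightarrow> dagger_mono C k \<Longrightarrow> is_kernel C k"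
  unfolding is_kernel_def by blast

lemma is_kernel_dagger_mono: "is_kernel C k \<Longrightarrow> dagger_mono C k"
  by (simp add: is_kernel_def)

lemma is_kernel_Arr: "is_kernel C k \<Longrightarrow> k \<in> Arr C"
  by (simp add: is_kernel_def dagger_mono_def)

end

text \<open>A chosen representative of the orthocomplement of the image of \<open>f\<close>.\<close>

definition perp :: "('o, 'a, 'm) dagger_cat_scheme \<Rightarrow> 'a \<Rightarrow> 'a" where
  "perp C f = (SOME k. kernel_of C k (f\<dagger>\<^bsub>C\<^esub>) \<and> dagger_mono C k)"

section \<open>Orthocomplements, closure properties and pullbacks of kernels\<close>

context dagger_kernel_category
begin

lemma ex_zero_arr:
  assumes "X \<in> Obj C" "Y \<in> Obj C"
  obtains f where "zero_arr C f" "Dom C f = X" "Cod C f = Y"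
proof -
  obtain Z where Z: "zero_object C Z"
    using ex_zero_object by blast
  obtain a where "a \<in> hom C X Z"
    by (rule zero_object_homE[OF Z assms(1)])
  moreover obtain b where "b \<in> hom C Z Y"
    by (rule zero_object_homE[OF Z assms(2)])
  ultimately have "b \<cdot> a \<in> Arr C" "Dom C (b \<cdot> a) = X" "Cod C (b \<cdot> a) = Y" "zero_arr C (b \<cdot> a)"
    using zero_arr_to_zero_object[OF Z, of a] zero_arr_comp_left[of a b] by (auto simp: hom_def)
  then show thesis using that by blast
qed

lemma perp_kernel_of:
  assumes "f \<in> Arr C"
  shows "kernel_of C (perp C f) (f\<dagger>)" "dagger_mono C (perp C f)"
  using someI_ex[OF ex_kernel[of "f\<dagger>"]] assms by (auto simp: perp_def)

lemma perp_simps [simp]: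
  assumes "f \<in> Arr C"
  shows "perp C f \<in> Arr C" "Cod C (perp C f) = Cod C f" "is_kernel C (perp C f)"
    "dagger_mono C (perp C f)"
  using perp_kernel_of[OF assms] kernel_ofD[OF perp_kernel_of(1)[OF assms]] assms
    kernel_of_is_kernel by auto

lemma zero_arr_perp:
  assumes "f \<in> Arr C"
  shows "zero_arr C (f\<dagger> \<cdot> perp C f)" "zero_arr C ((perp C f)\<dagger> \<cdot> f)"
proof -
  show *: "zero_arr C (f\<dagger> \<cdot> perp C f)"
    using kernel_ofD(4)[OF perp_kernel_of(1)[OF assms]] .
  show "zero_arr C ((perp C f)\<dagger> \<cdot> f)"
    using zero_arr_Dag[OF *] assms by simp
qed

lemma perp_factor:
  assumes "f \<in> Arr C" "g \<in> Arr C" "Cod C g = Cod C f" "zero_arr C (f\<dagger> \<cdot> g)"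
  shows "perp C f \<cdot> ((perp C f)\<dagger> \<cdot> g) = g"
  using kernel_of_factor[OF perp_kernel_of] assms by simp

text \<open>A kernel contains its double complement: if \<open>k\<close> is a kernel of
  \<open>f\<close>, then \<open>f\<dagger>\<close> is orthogonal to \<open>k\<close> and hence
  factors through \<open>perp C k\<close>, so whatever is orthogonal to \<open>perp C k\<close> is
  annihilated by \<open>f\<close>. The resulting test no longer mentions \<open>f\<close>.\<close>

lemma is_kernel_factor:
  assumes k: "is_kernel C k" and g: "g \<in> Arr C" "Cod C g = Cod C k"
    and z: "zero_arr C ((perp C k)\<dagger> \<cdot> g)"
  shows "k \<cdot> (k\<dagger> \<cdot> g) = g"
proof -
  obtain f where f: "kernel_of C k f" and dm: "dagger_mono C k"
    using k by (auto simp: is_kernel_def)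
  have a: "f \<in> Arr C" "k \<in> Arr C" "Cod C k = Dom C f" and "zero_arr C (f \<cdot> k)"
    using kernel_ofD[OF f] .
  let ?n = "perp C k"
  have "zero_arr C (k\<dagger> \<cdot> f\<dagger>)"
    using zero_arr_Dag[OF \<open>zero_arr C (f \<cdot> k)\<close>] a by simp
  then have "?n \<cdot> (?n\<dagger> \<cdot> f\<dagger>) = f\<dagger>"
    using perp_factor[of k "f\<dagger>"] a by simp
  then have "(?n \<cdot> (?n\<dagger> \<cdot> f\<dagger>))\<dagger> = (f\<dagger>)\<dagger>"
    by simp
  then have *: "f \<cdot> (?n \<cdot> ?n\<dagger>) = f"
    using a by simp
  have "zero_arr C ((f \<cdot> ?n) \<cdot> (?n\<dagger> \<cdot> g))"
    using a g by (intro zero_arr_comp_left[OF z]) auto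
  also have "(f \<cdot> ?n) \<cdot> (?n\<dagger> \<cdot> g) = (f \<cdot> (?n \<cdot> ?n\<dagger>)) \<cdot> g"
    using a g by simp
  finally show ?thesis
    unfolding * using kernel_of_factor[OF f dm] a g by simp
qed

lemma zero_arr_perp_Comp:
  assumes "k \<in> Arr C" "h \<in> Arr C" "Cod C h = Dom C k"
  shows "zero_arr C ((perp C k)\<dagger> \<cdot> (k \<cdot> h))"
  using zero_arr_comp_right[OF zero_arr_perp(2), of k h] assms by simp

lemma is_kernelI:
  assumes k: "dagger_mono C k"
    and *: "\<And>g. \<lbrakk>g \<in> Arr C; Cod C g = Cod C k; zero_arr C ((perp C k)\<dagger> \<cdot> g)\<rbrakk>
      \<Longrightarrow> k \<cdot> (k\<dagger> \<cdot> g) = g"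
  shows "is_kernel C k"
proof -
  have "k \<in> Arr C"
    using k by (simp add: dagger_mono_def)
  then have "kernel_of C k ((perp C k)\<dagger>)"
    using * by (intro kernel_ofI[OF k]) (auto simp: zero_arr_perp)
  then show ?thesis
    using k kernel_of_is_kernel by blast
qed

lemma is_kernel_kernel_of_perp:
  assumes "is_kernel C k"
  shows "kernel_of C k ((perp C k)\<dagger>)"
  using is_kernel_Arr[OF assms] is_kernel_factor[OF assms]
  by (intro kernel_ofI[OF is_kernel_dagger_mono[OF assms]]) (auto simp: zero_arr_perp)

lemma unitary_is_kernel:
  assumes "u \<in> Arr C" "u\<dagger> \<cdot> u = Id C (Dom C u)" "u \<cdot> u\<dagger> = Id C (Cod C u)"
  shows "is_kernel C u"
proof (rule is_kernelI)
  show "dagger_mono C u"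
    using assms by (simp add: dagger_mono_def)
  fix g assume "g \<in> Arr C" "Cod C g = Cod C u"
  then show "u \<cdot> (u\<dagger> \<cdot> g) = g"
    using assoc[of g "u\<dagger>" u] assms by simp
qed

lemma Id_is_kernel: "X \<in> Obj C \<Longrightarrow> is_kernel C (Id C X)"
  by (rule unitary_is_kernel) auto

text \<open>If \<open>h\<close> is orthogonal to the complement of \<open>m \<cdot> p\<close>, it is
  orthogonal to everything orthogonal to \<open>m \<cdot> p\<close>. Testing with
  \<open>perp C m\<close> puts \<open>h\<close> inside \<open>m\<close>; testing with
  \<open>m \<cdot> perp C p\<close> puts \<open>m\<dagger> \<cdot> h\<close> inside
  \<open>p\<close>.\<close>

lemma is_kernel_Comp:
  assumes m: "is_kernel C m" and p: "is_kernel C p" and dc: "Cod C p = Dom C m"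
  shows "is_kernel C (m \<cdot> p)"
proof (rule is_kernelI)
  note dm = is_kernel_dagger_mono[OF m] is_kernel_dagger_mono[OF p]
  note a [simp] = is_kernel_Arr[OF m] is_kernel_Arr[OF p]
  show "dagger_mono C (m \<cdot> p)"
    using dagger_mono_Comp dm dc by simp
  let ?r = "perp C (m \<cdot> p)"
  fix h assume h: "h \<in> Arr C" "Cod C h = Cod C (m \<cdot> p)" "zero_arr C (?r\<dagger> \<cdot> h)"
  have *: "zero_arr C (x\<dagger> \<cdot> h)"
    if x: "x \<in> Arr C" "Cod C x = Cod C m" "zero_arr C (p\<dagger> \<cdot> (m\<dagger> \<cdot> x))" for x
  proof -
    have "?r \<cdot> (?r\<dagger> \<cdot> x) = x"
      using perp_factor[of "m \<cdot> p" x] x dc by simp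
    then have "(?r \<cdot> (?r\<dagger> \<cdot> x))\<dagger> = x\<dagger>"
      by simp
    then have "x\<dagger> \<cdot> (?r \<cdot> ?r\<dagger>) = x\<dagger>"
      using x dc by simp
    moreover have "zero_arr C ((x\<dagger> \<cdot> ?r) \<cdot> (?r\<dagger> \<cdot> h))"
      using h x dc by (intro zero_arr_comp_left[OF h(3)]) auto
    moreover have "(x\<dagger> \<cdot> ?r) \<cdot> (?r\<dagger> \<cdot> h) = (x\<dagger> \<cdot> (?r \<cdot> ?r\<dagger>)) \<cdot> h"
      using h x dc by simp
    ultimately show ?thesis by simp
  qed
  have "zero_arr C (p\<dagger> \<cdot> (m\<dagger> \<cdot> perp C m))"
    using dc by (intro zero_arr_comp_left[OF zero_arr_perp(1)]) auto
  then have 1: "m \<cdot> (m\<dagger> \<cdot> h) = h"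
    using *[of "perp C m"] is_kernel_factor[OF m] h dc by simp
  have "zero_arr C (p\<dagger> \<cdot> (m\<dagger> \<cdot> (m \<cdot> perp C p)))"
    using dc dm by (simp add: zero_arr_perp)
  then have "zero_arr C ((perp C p)\<dagger> \<cdot> (m\<dagger> \<cdot> h))"
    using *[of "m \<cdot> perp C p"] h dc by simp
  then have "p \<cdot> (p\<dagger> \<cdot> (m\<dagger> \<cdot> h)) = m\<dagger> \<cdot> h"
    using is_kernel_factor[OF p, of "m\<dagger> \<cdot> h"] h dc by simp
  then show "(m \<cdot> p) \<cdot> ((m \<cdot> p)\<dagger> \<cdot> h) = h"
    using 1 h dc by simp
qed

text \<open>The complement of \<open>f\<close> is everything, so an arrow orthogonal to that
  complement is zero and factors through \<open>f\<close> trivially.\<close>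

lemma is_kernel_from_zero_object:
  assumes "zero_object C Z" "f \<in> Arr C" "Dom C f = Z"
  shows "is_kernel C f"
proof (rule is_kernelI)
  have zf: "zero_arr C f"
    using zero_arr_from_zero_object assms by blast
  have *: "f\<dagger> \<cdot> f = Id C Z"
    using zero_arr_from_zero_object[OF assms(1), of "f\<dagger> \<cdot> f"]
      zero_arr_from_zero_object[OF assms(1), of "Id C Z"] assms
    by (intro zero_arr_unique) (auto simp: zero_object_def)
  then show "dagger_mono C f"
    using assms by (simp add: dagger_mono_def)
  fix g assume g: "g \<in> Arr C" "Cod C g = Cod C f" "zero_arr C ((perp C f)\<dagger> \<cdot> g)"
  have "zero_arr C (f\<dagger> \<cdot> Id C (Cod C f))"
    using zero_arr_Dag[OF zf] assms by simp
  then have "perp C f \<cdot> (perp C f)\<dagger> = Id C (Cod C f)"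
    using perp_factor[of f "Id C (Cod C f)"] assms by simp
  then have "perp C f \<cdot> ((perp C f)\<dagger> \<cdot> g) = g"
    using assoc[of g "(perp C f)\<dagger>" "perp C f"] assms g by simp
  then have "zero_arr C g"
    using zero_arr_comp_left[OF g(3), of "perp C f"] assms g by simp
  then show "f \<cdot> (f\<dagger> \<cdot> g) = g"
    using assms g zero_arr_comp_left[of g "f\<dagger>"] zero_arr_comp_left[of "f\<dagger> \<cdot> g" f]
    by (intro zero_arr_unique) auto
qed

text \<open>The leg \<open>p\<close> cuts out the part of \<open>m\<close> that lies in
  \<open>n\<close>, as the kernel of \<open>m\<close> followed by the cokernel
  \<open>(perp C n)\<dagger>\<close>. The other leg is then forced to be
  \<open>n\<dagger> \<cdot> (m \<cdot> p)\<close>.\<close>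

lemma ex_kernel_pullback:
  assumes m: "is_kernel C m" and n: "is_kernel C n" and dc: "Cod C m = Cod C n"
  obtains p q where "is_pullback C m n p q" "is_kernel C p" "is_kernel C q"
proof -
  note dm [simp] = is_kernel_dagger_mono[OF m] is_kernel_dagger_mono[OF n]
  note a [simp] = is_kernel_Arr[OF m] is_kernel_Arr[OF n]
  have p0: "(perp C n)\<dagger> \<cdot> m \<in> Arr C"
    using dc by simp
  obtain p where ko: "kernel_of C p ((perp C n)\<dagger> \<cdot> m)" and p: "dagger_mono C p"
    using ex_kernel[OF p0] by blast
  have pa [simp]: "p \<in> Arr C" and pc [simp]: "Cod C p = Dom C m"
    and pz: "zero_arr C ((perp C n)\<dagger> \<cdot> (m \<cdot> p))"
    using kernel_ofD[OF ko] dc by simp_all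
  define q where "q = n\<dagger> \<cdot> (m \<cdot> p)"
  have q [simp]: "q \<in> Arr C" "Dom C q = Dom C p" "Cod C q = Dom C n"
    unfolding q_def using dc by auto
  have sq: "n \<cdot> q = m \<cdot> p"
    unfolding q_def using is_kernel_factor[OF n _ _ pz] dc by simp
  have sq': "n \<cdot> (q \<cdot> x) = m \<cdot> (p \<cdot> x)" if "x \<in> Arr C" "Cod C x = Dom C p" for x
    using sq that assoc[of x q n] assoc[of x p m] by simp
  \<comment> \<open>For a commuting cone, \<open>m \<cdot> x\<close> lies in \<open>n\<close> and is
    annihilated by \<open>(perp C n)\<dagger>\<close>, so \<open>x\<close> factors through
    \<open>p\<close>.\<close>
  have pf: "p \<cdot> (p\<dagger> \<cdot> x) = x"
    if x: "x \<in> Arr C" "Cod C x = Dom C m" and y: "y \<in> Arr C" "Cod C y = Dom C n"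
      and e: "m \<cdot> x = n \<cdot> y" for x y
    using kernel_of_factor[OF ko p, of x] x y dc e zero_arr_perp_Comp[of n y] by simp
  have "q\<dagger> \<cdot> q = (n \<cdot> q)\<dagger> \<cdot> (n \<cdot> q)"
    by simp
  also have "\<dots> = Id C (Dom C q)"
    unfolding sq using p by simp
  finally have qd: "dagger_mono C q"
    by (simp add: dagger_mono_def)
  \<comment> \<open>The description of \<open>q\<close> symmetric to that of \<open>p\<close>; it
    shows that \<open>q\<close> is a kernel and not merely a dagger mono.\<close>
  have "kernel_of C q ((perp C m)\<dagger> \<cdot> n)"
  proof (rule kernel_ofI[OF qd])
    show "zero_arr C (((perp C m)\<dagger> \<cdot> n) \<cdot> q)"
      using dc sq zero_arr_perp_Comp[of m p] by simp
    fix g assume g: "g \<in> Arr C" "Cod C g = Dom C ((perp C m)\<dagger> \<cdot> n)"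
      "zero_arr C (((perp C m)\<dagger> \<cdot> n) \<cdot> g)"
    let ?a = "m\<dagger> \<cdot> (n \<cdot> g)"
    have e: "m \<cdot> ?a = n \<cdot> g"
      using is_kernel_factor[OF m, of "n \<cdot> g"] g dc by simp
    have "n \<cdot> (q \<cdot> (p\<dagger> \<cdot> ?a)) = m \<cdot> (p \<cdot> (p\<dagger> \<cdot> ?a))"
      using sq' g dc by simp
    also have "\<dots> = n \<cdot> g"
      using pf[OF _ _ _ _ e] g dc e by simp
    finally have e': "n \<cdot> (q \<cdot> (p\<dagger> \<cdot> ?a)) = n \<cdot> g" .
    have "q \<cdot> (p\<dagger> \<cdot> ?a) = g"
      by (rule dagger_mono_cancel[OF dm(2) _ _ _ _ e']) (use g dc in simp_all)
    then have "q \<cdot> (q\<dagger> \<cdot> g) = q \<cdot> (q\<dagger> \<cdot> (q \<cdot> (p\<dagger> \<cdot> ?a)))"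
      by simp
    also have "\<dots> = q \<cdot> (p\<dagger> \<cdot> ?a)"
      using qd g dc by simp
    finally show "q \<cdot> (q\<dagger> \<cdot> g) = g"
      using \<open>q \<cdot> (p\<dagger> \<cdot> ?a) = g\<close> by simp
  qed (use dc in auto)
  then have qk: "is_kernel C q"
    using qd by (rule kernel_of_is_kernel)
  have pk: "is_kernel C p"
    using ko p by (rule kernel_of_is_kernel)
  have "\<exists>!h. h \<in> hom C X (Dom C p) \<and> p \<cdot> h = a \<and> q \<cdot> h = b"
    if h: "a \<in> hom C X (Dom C m)" "b \<in> hom C X (Dom C n)" "m \<cdot> a = n \<cdot> b" for X a b
  proof (rule ex1I)
    have ab: "a \<in> Arr C" "Cod C a = Dom C m" "b \<in> Arr C" "Cod C b = Dom C n"
      "Dom C a = X" "Dom C b = X"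
      using h by (auto simp: hom_def)
    then have *: "p \<cdot> (p\<dagger> \<cdot> a) = a"
      using pf h(3) by blast
    have "q \<cdot> (p\<dagger> \<cdot> a) = b"
      by (rule dagger_mono_cancel[OF dm(2)]) (use ab sq'[of "p\<dagger> \<cdot> a"] * h(3) in simp_all)
    then show "p\<dagger> \<cdot> a \<in> hom C X (Dom C p) \<and> p \<cdot> (p\<dagger> \<cdot> a) = a \<and> q \<cdot> (p\<dagger> \<cdot> a) = b"
      using * ab by (auto simp: hom_def)
    show "x = p\<dagger> \<cdot> a" if "x \<in> hom C X (Dom C p) \<and> p \<cdot> x = a \<and> q \<cdot> x = b" for x
      using that p by (auto simp: hom_def)
  qed
  then have "is_pullback C m n p q"
    using dc sq by (auto simp: is_pullback_def hom_def)
  then show thesis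
    using that pk qk by blast
qed

end

text \<open>Booleanness makes the projections onto kernels commute: \<open>m\<close> meets the complement of
  \<open>m \<and> n\<close> in \<open>n\<close> trivially, hence is orthogonal to it.\<close>

lemma (in boolean_dagger_kernel_category) Dag_Comp_kernels:
  assumes m: "is_kernel C m" and n: "is_kernel C n"
    and pb: "is_pullback C m n p q" and p: "is_kernel C p" and q: "is_kernel C q"
  shows "m\<dagger> \<cdot> n = p \<cdot> q\<dagger>"
proof -
  note dm [simp] = is_kernel_dagger_mono[OF m] is_kernel_dagger_mono[OF n]
    is_kernel_dagger_mono[OF p] is_kernel_dagger_mono[OF q]
  note a [simp] = is_kernel_Arr[OF m] is_kernel_Arr[OF n] is_kernel_Arr[OF p] is_kernel_Arr[OF q]
  have [simp]: "Cod C n = Cod C m" "Cod C p = Dom C m" "Cod C q = Dom C n" "Dom C q = Dom C p"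
    and sq: "m \<cdot> p = n \<cdot> q"
    and U: "\<And>X x y. \<lbrakk>x \<in> hom C X (Dom C m); y \<in> hom C X (Dom C n); m \<cdot> x = n \<cdot> y\<rbrakk>
         \<Longrightarrow> \<exists>!h. h \<in> hom C X (Dom C p) \<and> p \<cdot> h = x \<and> q \<cdot> h = y"
    using pb by (auto simp: is_pullback_def hom_def)
  let ?q' = "perp C q"
  have n': "is_kernel C (n \<cdot> ?q')"
    using n by (intro is_kernel_Comp) auto
  obtain s t where st: "is_pullback C m (n \<cdot> ?q') s t" "is_kernel C s" "is_kernel C t"
    using ex_kernel_pullback[OF m n'] by auto
  then have st' [simp]: "s \<in> Arr C" "t \<in> Arr C" "Cod C s = Dom C m" "Cod C t = Dom C ?q'"
      "Dom C t = Dom C s" "m \<cdot> s = n \<cdot> (?q' \<cdot> t)"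
    by (auto simp: is_pullback_def hom_def)
  obtain h where h: "h \<in> Arr C" "Cod C h = Dom C p" "Dom C h = Dom C s" "p \<cdot> h = s" "q \<cdot> h = ?q' \<cdot> t"
    using U[of s "Dom C s" "?q' \<cdot> t"] by (auto simp: hom_def)
  \<comment> \<open>The overlap of \<open>m\<close> with the part of \<open>n\<close> outside
    \<open>q\<close> lies both in \<open>q\<close> and in its complement \<open>?q'\<close>, so it
    vanishes.\<close>
  have "h = q\<dagger> \<cdot> (q \<cdot> h)"
    using h(1,2) by simp
  also have "\<dots> = (q\<dagger> \<cdot> ?q') \<cdot> t"
    unfolding h(5) by simp
  finally have "zero_arr C h"
    using zero_arr_comp_right[OF zero_arr_perp(1)[of q], of t] by simp
  then have "zero_arr C s"
    using zero_arr_comp_left[of h p] h by simp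
  then have "zero_arr C (m \<cdot> s)"
    using zero_arr_comp_left[of s m] by simp
  then have "zero_arr C (m\<dagger> \<cdot> (n \<cdot> ?q'))"
    using boolean[OF m n' _ st(1)] by simp
  \<comment> \<open>Read backwards, \<open>n\<dagger> \<cdot> m\<close> is orthogonal to the
    complement of \<open>q\<close>. It therefore factors through \<open>q\<close>, and the factor
    computes to \<open>p\<dagger>\<close>.\<close>
  then have "zero_arr C ((m\<dagger> \<cdot> (n \<cdot> ?q'))\<dagger>)"
    by (rule zero_arr_Dag)
  then have "q \<cdot> (q\<dagger> \<cdot> (n\<dagger> \<cdot> m)) = n\<dagger> \<cdot> m"
    using is_kernel_factor[OF q, of "n\<dagger> \<cdot> m"] by simp
  also have "q\<dagger> \<cdot> (n\<dagger> \<cdot> m) = (m \<cdot> p)\<dagger> \<cdot> m"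
    unfolding sq by simp
  also have "\<dots> = p\<dagger>"
    using arg_cong[OF dagger_mono_simps(1)[OF dm(1)], of "\<lambda>x. p\<dagger> \<cdot> x"] by simp
  finally have "(q \<cdot> p\<dagger>)\<dagger> = (n\<dagger> \<cdot> m)\<dagger>"
    by simp
  then show ?thesis
    by simp
qed

section \<open>Kernel posets and the kernel fibration\<close>

text \<open>The condition on arrows of \<open>kernel_fibration\<close>, isolated because its
  instance at the identity is the order \<open>ksub_le\<close>; one transfer result then serves
  both.\<close>

definition fib_rel :: "('o, 'a, 'm) dagger_cat_scheme \<Rightarrow> 'a \<Rightarrow> 'a set \<Rightarrow> 'a set \<Rightarrow> bool" where
  "fib_rel C f A B \<longleftrightarrow>
    (\<exists>m \<in> A. \<exists>n \<in> B. \<exists>h \<in> hom C (Dom C m) (Dom C n). f \<cdot>\<^bsub>C\<^esub> m = n \<cdot>\<^bsub>C\<^esub> h)"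

context dagger_kernel_category
begin

text \<open>An isomorphism \<open>\<phi>\<close> with \<open>n = m \<cdot> \<phi>\<close> must be
  \<open>m\<dagger> \<cdot> n\<close>, with inverse \<open>n\<dagger> \<cdot> m\<close>, and these
  are inverse to each other as soon as the projections agree. Hence the projection is a complete
  invariant of the class.\<close>

lemma ksub_class_iff:
  assumes m: "is_kernel C m"
  shows "n \<in> ksub_class C m \<longleftrightarrow> is_kernel C n \<and> Cod C n = Cod C m \<and> n \<cdot> n\<dagger> = m \<cdot> m\<dagger>"
proof
  note [simp] = is_kernel_dagger_mono[OF m] is_kernel_Arr[OF m]
  {
    assume "n \<in> ksub_class C m"
    then obtain \<phi> \<psi> where n: "is_kernel C n" and i: "inverse_arrows C \<phi> \<psi>"
      and \<phi>: "\<phi> \<in> hom C (Dom C n) (Dom C m)" "n = m \<cdot> \<phi>"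
      unfolding ksub_class_def by blast
    note [simp] = is_kernel_dagger_mono[OF n] is_kernel_Arr[OF n]
    have [simp]: "\<phi> \<in> Arr C" "\<psi> \<in> Arr C" "Dom C \<phi> = Dom C n" "Cod C \<phi> = Dom C m"
        "Dom C \<psi> = Dom C m" "Cod C \<psi> = Dom C n"
      and e: "\<phi> \<cdot> \<psi> = Id C (Dom C m)"
      using i \<phi>(1) by (auto simp: inverse_arrows_def hom_def)
    note n' = \<phi>(2)[symmetric]
    have dc: "Cod C n = Cod C m"
      using arg_cong[OF n', of "Cod C"] by simp
    have "m\<dagger> \<cdot> n = \<phi>"
      unfolding n'[symmetric] by simp
    have mm: "m \<cdot> (m\<dagger> \<cdot> n) = n"
      unfolding \<open>m\<dagger> \<cdot> n = \<phi>\<close> by (rule n')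
    have "n \<cdot> \<psi> = m"
      using e assoc[of \<psi> \<phi> m] n' by simp
    then have "n\<dagger> \<cdot> m = \<psi>"
      using dagger_mono_simps(2)[of n \<psi>] by simp
    then have nn: "n \<cdot> (n\<dagger> \<cdot> m) = m"
      using \<open>n \<cdot> \<psi> = m\<close> by simp
    have "n \<cdot> n\<dagger> = (m \<cdot> (m\<dagger> \<cdot> n)) \<cdot> n\<dagger>"
      using mm by simp
    also have "\<dots> = m \<cdot> (n \<cdot> (n\<dagger> \<cdot> m))\<dagger>"
      using dc by simp
    finally show "is_kernel C n \<and> Cod C n = Cod C m \<and> n \<cdot> n\<dagger> = m \<cdot> m\<dagger>"
      using n dc nn by simp
  }
  assume r: "is_kernel C n \<and> Cod C n = Cod C m \<and> n \<cdot> n\<dagger> = m \<cdot> m\<dagger>"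
  then have n: "is_kernel C n" and dc [simp]: "Cod C n = Cod C m" and e: "n \<cdot> n\<dagger> = m \<cdot> m\<dagger>"
    by auto
  note [simp] = is_kernel_dagger_mono[OF n] is_kernel_Arr[OF n]
  have e': "n \<cdot> (n\<dagger> \<cdot> x) = m \<cdot> (m\<dagger> \<cdot> x)" if "x \<in> Arr C" "Cod C x = Cod C m" for x
    using that e assoc[of x "n\<dagger>" n] assoc[of x "m\<dagger>" m] by simp
  have mn: "m \<cdot> (m\<dagger> \<cdot> n) = n" and nm: "n \<cdot> (n\<dagger> \<cdot> m) = m"
    using e'[of n] e'[of m] by auto
  have "(n\<dagger> \<cdot> m) \<cdot> (m\<dagger> \<cdot> n) = n\<dagger> \<cdot> (m \<cdot> (m\<dagger> \<cdot> n))"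
    by simp
  then have 1: "(n\<dagger> \<cdot> m) \<cdot> (m\<dagger> \<cdot> n) = Id C (Dom C n)"
    unfolding mn by simp
  have "(m\<dagger> \<cdot> n) \<cdot> (n\<dagger> \<cdot> m) = m\<dagger> \<cdot> (n \<cdot> (n\<dagger> \<cdot> m))"
    by simp
  then have 2: "(m\<dagger> \<cdot> n) \<cdot> (n\<dagger> \<cdot> m) = Id C (Dom C m)"
    unfolding nm by simp
  have "inverse_arrows C (m\<dagger> \<cdot> n) (n\<dagger> \<cdot> m)"
    unfolding inverse_arrows_def using 1 2 by (simp add: hom_def)
  moreover have "m\<dagger> \<cdot> n \<in> hom C (Dom C n) (Dom C m)"
    by (simp add: hom_def)
  ultimately show "n \<in> ksub_class C m"
    using n mn[symmetric] unfolding ksub_class_def by blast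
qed

lemma ksub_class_self: "is_kernel C m \<Longrightarrow> m \<in> ksub_class C m"
  by (simp add: ksub_class_iff)

lemma ksub_class_eq:
  assumes "is_kernel C m" "n \<in> ksub_class C m"
  shows "ksub_class C n = ksub_class C m"
  using assms ksub_class_iff[of m] ksub_class_iff[of n] by auto

lemma KSubE:
  assumes "A \<in> KSub C X"
  obtains m where "is_kernel C m" "Cod C m = X" "A = ksub_class C m"
  using assms unfolding KSub_def by blast

lemma KSubI: "is_kernel C m \<Longrightarrow> Cod C m = X \<Longrightarrow> ksub_class C m \<in> KSub C X"
  unfolding KSub_def by blast

lemma KSub_kernel: "A \<in> KSub C X \<Longrightarrow> m \<in> A \<Longrightarrow> is_kernel C m \<and> Cod C m = X"
  by (erule KSubE) (auto simp: ksub_class_iff)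

lemma KSub_eq_ksub_class: "A \<in> KSub C X \<Longrightarrow> m \<in> A \<Longrightarrow> ksub_class C m = A"
  by (erule KSubE) (auto simp: ksub_class_eq)

lemma KSub_nonempty: "A \<in> KSub C X \<Longrightarrow> \<exists>m. m \<in> A"
  by (erule KSubE) (auto intro: ksub_class_self)

text \<open>Composing with \<open>m\<dagger>\<close> or \<open>m\<close> on the right passes between
  the two equations. The second one sees \<open>m\<close> and \<open>n\<close> only through their
  projections, so it does not depend on representatives.\<close>

lemma factor_iff_proj:
  assumes "m \<in> Arr C" "dagger_mono C m" "n \<in> Arr C" "f \<in> Arr C" "Dom C f = Cod C m" "Cod C f = Cod C n"
  shows "n \<cdot> (n\<dagger> \<cdot> (f \<cdot> m)) = f \<cdot> m \<longleftrightarrow> (n \<cdot> n\<dagger>) \<cdot> (f \<cdot> (m \<cdot> m\<dagger>)) = f \<cdot> (m \<cdot> m\<dagger>)"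
proof
  assume "n \<cdot> (n\<dagger> \<cdot> (f \<cdot> m)) = f \<cdot> m"
  then have "(n \<cdot> (n\<dagger> \<cdot> (f \<cdot> m))) \<cdot> m\<dagger> = (f \<cdot> m) \<cdot> m\<dagger>"
    by simp
  then show "(n \<cdot> n\<dagger>) \<cdot> (f \<cdot> (m \<cdot> m\<dagger>)) = f \<cdot> (m \<cdot> m\<dagger>)"
    using assms by simp
next
  assume "(n \<cdot> n\<dagger>) \<cdot> (f \<cdot> (m \<cdot> m\<dagger>)) = f \<cdot> (m \<cdot> m\<dagger>)"
  then have "((n \<cdot> n\<dagger>) \<cdot> (f \<cdot> (m \<cdot> m\<dagger>))) \<cdot> m = (f \<cdot> (m \<cdot> m\<dagger>)) \<cdot> m"
    by simp
  then show "n \<cdot> (n\<dagger> \<cdot> (f \<cdot> m)) = f \<cdot> m"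
    using assms by simp
qed

text \<open>Projections are constant on classes, so the existential over representatives can be
  tested at any chosen pair.\<close>

lemma fib_rel_iff:
  assumes A: "A \<in> KSub C X" "m \<in> A" and B: "B \<in> KSub C Y" "n \<in> B" and f: "f \<in> hom C X Y"
  shows "fib_rel C f A B \<longleftrightarrow> n \<cdot> (n\<dagger> \<cdot> (f \<cdot> m)) = f \<cdot> m"
proof
  have f' [simp]: "f \<in> Arr C" "Dom C f = X" "Cod C f = Y"
    using f by (auto simp: hom_def)
  note mn = KSub_kernel[OF A] KSub_kernel[OF B]
  have mn' [simp]: "m \<in> Arr C" "dagger_mono C m" "Cod C m = X" "n \<in> Arr C" "dagger_mono C n" "Cod C n = Y"
    using mn is_kernel_Arr is_kernel_dagger_mono by auto
  {
    assume "fib_rel C f A B"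
    then obtain m' n' h where r: "m' \<in> A" "n' \<in> B" "h \<in> hom C (Dom C m') (Dom C n')" "f \<cdot> m' = n' \<cdot> h"
      unfolding fib_rel_def by blast
    have mn'' [simp]: "m' \<in> Arr C" "dagger_mono C m'" "Cod C m' = X" "n' \<in> Arr C" "dagger_mono C n'" "Cod C n' = Y"
      using KSub_kernel[OF A(1) r(1)] KSub_kernel[OF B(1) r(2)] is_kernel_Arr is_kernel_dagger_mono by auto
    have pr: "m' \<cdot> m'\<dagger> = m \<cdot> m\<dagger>" "n' \<cdot> n'\<dagger> = n \<cdot> n\<dagger>"
      using KSub_eq_ksub_class[OF A] KSub_eq_ksub_class[OF B] r(1,2) mn ksub_class_iff by blast+
    have "n' \<cdot> (n'\<dagger> \<cdot> (f \<cdot> m')) = f \<cdot> m'"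
      unfolding r(4) using r(3) by (simp add: hom_def)
    then show "n \<cdot> (n\<dagger> \<cdot> (f \<cdot> m)) = f \<cdot> m"
      by (subst factor_iff_proj; subst (asm) factor_iff_proj) (simp_all add: pr)
  }
  assume "n \<cdot> (n\<dagger> \<cdot> (f \<cdot> m)) = f \<cdot> m"
  moreover have "n\<dagger> \<cdot> (f \<cdot> m) \<in> hom C (Dom C m) (Dom C n)"
    by (simp add: hom_def)
  ultimately show "fib_rel C f A B"
    using A(2) B(2) unfolding fib_rel_def by metis
qed

lemma ksub_le_fib_rel:
  assumes "A \<in> KSub C X"
  shows "ksub_le C A B \<longleftrightarrow> fib_rel C (Id C X) A B"
proof -
  have "Id C X \<cdot> m = m" if "m \<in> A" for m
    using KSub_kernel[OF assms that] is_kernel_Arr by auto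
  then show ?thesis
    unfolding ksub_le_def fib_rel_def by auto
qed

lemma KSub_Obj: "A \<in> KSub C X \<Longrightarrow> X \<in> Obj C"
  by (erule KSubE) (use is_kernel_Arr in auto)

lemma fib_rel_Id:
  assumes "A \<in> KSub C X"
  shows "fib_rel C (Id C X) A A"
proof -
  obtain m where m: "m \<in> A"
    using KSub_nonempty[OF assms] by blast
  then have "is_kernel C m" "Cod C m = X"
    using KSub_kernel assms by blast+
  then have "m \<cdot> (m\<dagger> \<cdot> (Id C X \<cdot> m)) = Id C X \<cdot> m"
    using is_kernel_Arr is_kernel_dagger_mono by auto
  then show ?thesis
    using fib_rel_iff[OF assms m assms m Id_hom[OF KSub_Obj[OF assms]]] by simp
qed

lemma fib_rel_Comp:
  assumes A: "A \<in> KSub C X" and B: "B \<in> KSub C Y" and D: "D \<in> KSub C Z"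
    and f: "f \<in> hom C X Y" and g: "g \<in> hom C Y Z"
    and r: "fib_rel C f A B" "fib_rel C g B D"
  shows "fib_rel C (g \<cdot> f) A D"
proof -
  obtain m n l where mnl: "m \<in> A" "n \<in> B" "l \<in> D"
    using KSub_nonempty[OF A] KSub_nonempty[OF B] KSub_nonempty[OF D] by blast
  have [simp]: "m \<in> Arr C" "Cod C m = X" "n \<in> Arr C" "Cod C n = Y" "l \<in> Arr C" "Cod C l = Z"
      "dagger_mono C l"
    using KSub_kernel[OF A mnl(1)] KSub_kernel[OF B mnl(2)] KSub_kernel[OF D mnl(3)]
      is_kernel_Arr is_kernel_dagger_mono by auto
  have [simp]: "f \<in> Arr C" "Dom C f = X" "Cod C f = Y" "g \<in> Arr C" "Dom C g = Y" "Cod C g = Z"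
    using f g by (auto simp: hom_def)
  have 1: "n \<cdot> (n\<dagger> \<cdot> (f \<cdot> m)) = f \<cdot> m"
    using fib_rel_iff[OF A mnl(1) B mnl(2) f] r by simp
  have 2: "l \<cdot> (l\<dagger> \<cdot> (g \<cdot> n)) = g \<cdot> n"
    using fib_rel_iff[OF B mnl(2) D mnl(3) g] r by simp
  have "l \<cdot> (l\<dagger> \<cdot> (g \<cdot> (f \<cdot> m))) = l \<cdot> (l\<dagger> \<cdot> (g \<cdot> (n \<cdot> (n\<dagger> \<cdot> (f \<cdot> m)))))"
    unfolding 1 ..
  also have "\<dots> = (l \<cdot> (l\<dagger> \<cdot> (g \<cdot> n))) \<cdot> (n\<dagger> \<cdot> (f \<cdot> m))"
    by simp
  also have "\<dots> = g \<cdot> (f \<cdot> m)"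
    unfolding 2 using 1 by simp
  finally have "l \<cdot> (l\<dagger> \<cdot> ((g \<cdot> f) \<cdot> m)) = (g \<cdot> f) \<cdot> m"
    by simp
  then show ?thesis
    using fib_rel_iff[OF A mnl(1) D mnl(3), of "g \<cdot> f"] by (simp add: hom_def)
qed

section \<open>The total category of the kernel fibration and its projection\<close>

lemma kernel_fibration_simps:
  "Obj (kernel_fibration C) = {(X, A). A \<in> KSub C X}"
  "Arr (kernel_fibration C) = {((X, A), f, (Y, B)). A \<in> KSub C X \<and> B \<in> KSub C Y
    \<and> f \<in> hom C X Y \<and> fib_rel C f A B}"
  "Dom (kernel_fibration C) (a, f, b) = a"
  "Cod (kernel_fibration C) (a, f, b) = b"
  "Id (kernel_fibration C) a = (a, Id C (fst a), a)"
  "(b, g, c) \<cdot>\<^bsub>kernel_fibration C\<^esub> (a, f, b') = (a, g \<cdot> f, c)"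
  by (auto simp: kernel_fibration_def fib_rel_def KSub_Obj)

lemma kernel_fibration_ArrI:
  assumes "A \<in> KSub C X" "B \<in> KSub C Y" "f \<in> hom C X Y" "fib_rel C f A B"
  shows "((X, A), f, (Y, B)) \<in> Arr (kernel_fibration C)"
  using assms by (simp add: kernel_fibration_simps)

lemma kernel_fibration_ArrE:
  assumes "t \<in> Arr (kernel_fibration C)"
  obtains X A f Y B where "t = ((X, A), f, (Y, B))" "A \<in> KSub C X" "B \<in> KSub C Y"
    "f \<in> hom C X Y" "fib_rel C f A B"
  using assms by (auto simp: kernel_fibration_simps)

lemma category_kernel_fibration: "category (kernel_fibration C)"
proof
  fix t assume "t \<in> Arr (kernel_fibration C)"
  then show "Dom (kernel_fibration C) t \<in> Obj (kernel_fibration C)"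
    "Cod (kernel_fibration C) t \<in> Obj (kernel_fibration C)"
    by (auto elim!: kernel_fibration_ArrE simp: kernel_fibration_simps)
next
  fix a assume "a \<in> Obj (kernel_fibration C)"
  then show "Id (kernel_fibration C) a \<in> hom (kernel_fibration C) a a"
    using fib_rel_Id Id_hom KSub_Obj
    by (auto simp: hom_def[of "kernel_fibration C"] kernel_fibration_simps)
next
  fix s t a b c
  assume "s \<in> hom (kernel_fibration C) a b" "t \<in> hom (kernel_fibration C) b c"
  then show "t \<cdot>\<^bsub>kernel_fibration C\<^esub> s \<in> hom (kernel_fibration C) a c"
    by (auto simp: hom_def[of "kernel_fibration C"] kernel_fibration_simps
        intro: Comp_hom fib_rel_Comp)
next
  fix s a b assume s: "s \<in> hom (kernel_fibration C) a b"
  then show "s \<cdot>\<^bsub>kernel_fibration C\<^esub> Id (kernel_fibration C) a = s"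
    "Id (kernel_fibration C) b \<cdot>\<^bsub>kernel_fibration C\<^esub> s = s"
    by (auto simp: hom_def[of "kernel_fibration C"] kernel_fibration_simps Comp_Id Id_Comp)
next
  fix s t u a b c d
  assume "s \<in> hom (kernel_fibration C) a b" "t \<in> hom (kernel_fibration C) b c"
    "u \<in> hom (kernel_fibration C) c d"
  then show "(u \<cdot>\<^bsub>kernel_fibration C\<^esub> t) \<cdot>\<^bsub>kernel_fibration C\<^esub> s
      = u \<cdot>\<^bsub>kernel_fibration C\<^esub> (t \<cdot>\<^bsub>kernel_fibration C\<^esub> s)"
    by (auto simp: hom_def[of "kernel_fibration C"] kernel_fibration_simps Comp_assoc)
qed

lemma is_functor_kernel_fibration_proj:
  "is_functor (kernel_fibration C) C kernel_fibration_proj"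
  unfolding is_functor_def kernel_fibration_proj_def
  using category_kernel_fibration category_axioms KSub_Obj
  by (auto simp: kernel_fibration_simps)

end

section \<open>Cokernel-kernel factorisations\<close>

text \<open>These are the base arrows in the image of the functor from pairs to
  \<open>C\<close>.\<close>

definition kck_arr :: "('o, 'a, 'm) dagger_cat_scheme \<Rightarrow> 'a \<Rightarrow> bool" where
  "kck_arr C f \<longleftrightarrow> (\<exists>c k. kck_pair C c k \<and> k \<cdot>\<^bsub>C\<^esub> c = f)"

text \<open>The cokernel-kernel factorisations of \<open>f\<close> form a single equivalence class, so the functor
  to the base is injective on arrows.\<close>

definition kck_of :: "('o, 'a, 'm) dagger_cat_scheme \<Rightarrow> 'a \<Rightarrow> ('a \<times> 'a) set" where
  "kck_of C f = {(c, k). kck_pair C c k \<and> k \<cdot>\<^bsub>C\<^esub> c = f}"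

context dagger_kernel_category
begin

lemma kck_pairD:
  assumes "kck_pair C c k"
  shows "c \<in> Arr C" "k \<in> Arr C" "dagger_mono C k" "dagger_mono C (c\<dagger>)" "is_kernel C (c\<dagger>)"
    "is_kernel C k" "Cod C c = Dom C k"
  using assms is_kernel_dagger_mono is_kernel_Arr unfolding kck_pair_def is_cokernel_def by auto

lemma cokernel_simps:
  assumes "kck_pair C c k"
  shows "c \<cdot> c\<dagger> = Id C (Dom C k)"
    and "x \<in> Arr C \<Longrightarrow> Cod C x = Cod C c \<Longrightarrow> c \<cdot> (c\<dagger> \<cdot> x) = x"
  using dagger_mono_simps[OF kck_pairD(4)[OF assms]] kck_pairD[OF assms] by auto

text \<open>Since \<open>k\<close> is dagger mono,
  \<open>(k \<cdot> c)\<dagger> \<cdot> (k \<cdot> c)\<close> equals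
  \<open>c\<dagger> \<cdot> c\<close>, which therefore depends only on the composite. Two
  factorisations are then linked by \<open>c' \<cdot> c\<dagger>\<close>, whose inverse is
  \<open>c \<cdot> c'\<dagger>\<close>.\<close>

lemma kck_class_eq_kck_of:
  assumes ck: "kck_pair C c k"
  shows "kck_class C c k = kck_of C (k \<cdot> c)"
proof -
  note [simp] = kck_pairD[OF ck]
  have "kck_pair C c' k' \<and> k' \<cdot> c' = k \<cdot> c" if "(c', k') \<in> kck_class C c k" for c' k'
  proof -
    obtain \<phi> \<psi> where p: "kck_pair C c' k'" and i: "inverse_arrows C \<phi> \<psi>"
      and d: "Dom C \<phi> = Cod C c" and e: "c' = \<phi> \<cdot> c" "k' = k \<cdot> \<psi>"
      using \<open>(c', k') \<in> kck_class C c k\<close> unfolding kck_class_def by blast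
    have [simp]: "\<phi> \<in> Arr C" "\<psi> \<in> Arr C" "Dom C \<phi> = Dom C k" "Cod C \<psi> = Dom C k"
        "Dom C \<psi> = Cod C \<phi>" "\<psi> \<cdot> \<phi> = Id C (Dom C k)"
      using i d by (auto simp: inverse_arrows_def hom_def)
    have "(k \<cdot> \<psi>) \<cdot> (\<phi> \<cdot> c) = k \<cdot> ((\<psi> \<cdot> \<phi>) \<cdot> c)"
      by (simp del: \<open>\<psi> \<cdot> \<phi> = Id C (Dom C k)\<close>)
    then have "k' \<cdot> c' = k \<cdot> c"
      unfolding e by simp
    then show ?thesis
      using p by blast
  qed
  moreover have "(c', k') \<in> kck_class C c k"
    if ck': "kck_pair C c' k'" and e: "k' \<cdot> c' = k \<cdot> c" for c' k'
  proof -
    note [simp] = kck_pairD[OF ck']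
    have [simp]: "Cod C k' = Cod C k" "Dom C c' = Dom C c"
      using arg_cong[OF e, of "Cod C"] arg_cong[OF e, of "Dom C"] by auto
    have "(k' \<cdot> c')\<dagger> \<cdot> (k' \<cdot> c') = (k \<cdot> c)\<dagger> \<cdot> (k \<cdot> c)"
      unfolding e ..
    then have cc: "c'\<dagger> \<cdot> c' = c\<dagger> \<cdot> c"
      by simp
    then have cc': "c'\<dagger> \<cdot> (c' \<cdot> x) = c\<dagger> \<cdot> (c \<cdot> x)" if "x \<in> Arr C" "Cod C x = Dom C c" for x
      using assoc[of x c' "c'\<dagger>"] assoc[of x c "c\<dagger>"] that by simp
    have "(c \<cdot> c'\<dagger>) \<cdot> (c' \<cdot> c\<dagger>) = c \<cdot> (c\<dagger> \<cdot> (c \<cdot> c\<dagger>))"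
      using cc' by simp
    then have 1: "(c \<cdot> c'\<dagger>) \<cdot> (c' \<cdot> c\<dagger>) = Id C (Dom C k)"
      using cokernel_simps[OF ck] by simp
    have "(c' \<cdot> c\<dagger>) \<cdot> (c \<cdot> c'\<dagger>) = c' \<cdot> (c'\<dagger> \<cdot> (c' \<cdot> c'\<dagger>))"
      using cc' by simp
    then have 2: "(c' \<cdot> c\<dagger>) \<cdot> (c \<cdot> c'\<dagger>) = Id C (Dom C k')"
      using cokernel_simps[OF ck'] by simp
    have inv: "inverse_arrows C (c' \<cdot> c\<dagger>) (c \<cdot> c'\<dagger>)"
      unfolding inverse_arrows_def using 1 2 by (simp add: hom_def)
    have "(c' \<cdot> c\<dagger>) \<cdot> c = c' \<cdot> (c'\<dagger> \<cdot> c')"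
      unfolding cc by simp
    then have 3: "c' = (c' \<cdot> c\<dagger>) \<cdot> c"
      using cokernel_simps(2)[OF ck', of c'] by simp
    have "k \<cdot> (c \<cdot> c'\<dagger>) = (k \<cdot> c) \<cdot> c'\<dagger>"
      by simp
    also have "\<dots> = k'"
      unfolding e[symmetric] by (simp add: cokernel_simps[OF ck'])
    finally have 4: "k' = k \<cdot> (c \<cdot> c'\<dagger>)" ..
    have "Dom C (c' \<cdot> c\<dagger>) = Cod C c"
      by simp
    with inv 3 4 ck' show ?thesis
      unfolding kck_class_def by (intro CollectI case_prodI conjI exI)
  qed
  ultimately show ?thesis
    unfolding kck_of_def by blast
qed

lemma kck_arr_Arr: "kck_arr C f \<Longrightarrow> f \<in> Arr C"
  unfolding kck_arr_def using kck_pairD by fastforce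

lemma kck_of_nonempty: "kck_arr C f \<Longrightarrow> kck_of C f \<noteq> {}"
  unfolding kck_arr_def kck_of_def by blast

lemma kck_of_memD:
  assumes "(c, k) \<in> kck_of C f"
  shows "kck_pair C c k" "k \<cdot> c = f" "Dom C c = Dom C f" "Cod C k = Cod C f"
  using assms kck_pairD unfolding kck_of_def by auto

lemma kck_of_inject:
  assumes "kck_arr C f" "kck_of C f = kck_of C g"
  shows "f = g"
proof -
  obtain c k where "(c, k) \<in> kck_of C f"
    using kck_of_nonempty[OF assms(1)] by fast
  then show ?thesis
    using kck_of_memD(2) assms(2) by metis
qed

lemma kck_of_inject_iff: "kck_arr C f \<Longrightarrow> kck_arr C g \<Longrightarrow> kck_of C f = kck_of C g \<longleftrightarrow> f = g"
  using kck_of_inject by blast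

lemma Obj_kck [simp]: "Obj (kck C) = Obj C"
  by (simp add: kck_def)

lemma Arr_kck: "Arr (kck C) = kck_of C ` {f. kck_arr C f}"
  using kck_class_eq_kck_of by (fastforce simp: kck_def kck_arr_def image_def)

text \<open>\<open>Dom\<close> and \<open>Cod\<close> of \<open>kck C\<close> and the arrow part of
  \<open>kck_functor C\<close> all apply \<open>the_elem\<close> to an image of a class; this
  evaluates them once the function is constant on the class.\<close>

lemma the_elem_image_kck_of:
  assumes "kck_arr C f" "\<And>c k. (c, k) \<in> kck_of C f \<Longrightarrow> h c k = y"
  shows "the_elem ((\<lambda>(c, k). h c k) ` kck_of C f) = y"
proof -
  have "(\<lambda>(c, k). h c k) ` kck_of C f = {y}"
    using kck_of_nonempty[OF assms(1)] assms(2) by force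
  then show ?thesis
    by simp
qed

lemma Dom_kck [simp]: "kck_arr C f \<Longrightarrow> Dom (kck C) (kck_of C f) = Dom C f"
  and Cod_kck [simp]: "kck_arr C f \<Longrightarrow> Cod (kck C) (kck_of C f) = Cod C f"
  using kck_of_memD by (simp_all add: kck_def the_elem_image_kck_of)

lemma FObj_kck_functor [simp]: "FObj (kck_functor C) X = X"
  by (simp add: kck_functor_def)

lemma FArr_kck_functor [simp]: "kck_arr C f \<Longrightarrow> FArr (kck_functor C) (kck_of C f) = f"
  using kck_of_memD by (simp add: kck_functor_def the_elem_image_kck_of)

lemma kck_pair_Dag:
  assumes "kck_pair C c k"
  shows "kck_pair C (k\<dagger>) (c\<dagger>)"
  using kck_pairD[OF assms] unfolding kck_pair_def is_cokernel_def by simp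

lemma kck_of_Dag:
  assumes "kck_arr C f"
  shows "kck_arr C (f\<dagger>)" "(kck_of C f)\<dagger>\<^bsub>kck C\<^esub> = kck_of C (f\<dagger>)"
proof -
  have *: "(k\<dagger>, c\<dagger>) \<in> kck_of C (g\<dagger>)" if ck: "(c, k) \<in> kck_of C g" for c k g
    using kck_of_memD(2)[OF ck, symmetric] kck_pair_Dag[OF kck_of_memD(1)[OF ck]]
      kck_pairD[OF kck_of_memD(1)[OF ck]] by (simp add: kck_of_def)
  have f: "f \<in> Arr C"
    using kck_arr_Arr assms by blast
  show "kck_arr C (f\<dagger>)"
    using * kck_of_nonempty[OF assms] unfolding kck_of_def kck_arr_def by blast
  \<comment> \<open>Reverse inclusion: as the dagger is involutive, each factorisation of
    \<open>f\<dagger>\<close> is the dagger of one of \<open>f\<close>.\<close>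
  have "(c, k) \<in> (\<lambda>(c, k). (k\<dagger>, c\<dagger>)) ` kck_of C f" if ck: "(c, k) \<in> kck_of C (f\<dagger>)" for c k
    using *[OF ck] kck_pairD[OF kck_of_memD(1)[OF ck]] f
    by (intro image_eqI[of _ _ "(k\<dagger>, c\<dagger>)"]) auto
  then have "(\<lambda>(c, k). (k\<dagger>, c\<dagger>)) ` kck_of C f = kck_of C (f\<dagger>)"
    using * by auto
  then show "(kck_of C f)\<dagger>\<^bsub>kck C\<^esub> = kck_of C (f\<dagger>)"
    by (simp add: kck_def)
qed

lemma is_kernel_kck_arr:
  assumes "is_kernel C k"
  shows "kck_arr C k"
proof -
  have "kck_pair C (Id C (Dom C k)) k" "k \<cdot> Id C (Dom C k) = k"
    using assms is_kernel_Arr[OF assms] Id_is_kernel by (auto simp: kck_pair_def is_cokernel_def)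
  then show ?thesis
    unfolding kck_arr_def by blast
qed

lemma Id_kck_arr: "X \<in> Obj C \<Longrightarrow> kck_arr C (Id C X)"
  using is_kernel_kck_arr Id_is_kernel by blast

lemma Id_kck:
  assumes "X \<in> Obj C"
  shows "Id (kck C) X = kck_of C (Id C X)"
proof -
  have "kck_pair C (Id C X) (Id C X)"
    using assms Id_is_kernel by (auto simp: kck_pair_def is_cokernel_def)
  from kck_class_eq_kck_of[OF this] show ?thesis
    using assms by (simp add: kck_def)
qed

lemma kck_arr_from_zero_object:
  assumes "zero_object C Z" "f \<in> Arr C" "Dom C f = Z"
  shows "kck_arr C f"
  using is_kernel_from_zero_object[OF assms] is_kernel_kck_arr by blast

lemma kck_arr_to_zero_object:
  assumes "zero_object C Z" "f \<in> Arr C" "Cod C f = Z"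
  shows "kck_arr C f"
  using kck_arr_from_zero_object[of Z "f\<dagger>"] kck_of_Dag(1)[of "f\<dagger>"] assms by simp

lemma Arr_kckE:
  assumes "x \<in> Arr (kck C)"
  obtains f where "kck_arr C f" "f \<in> Arr C" "x = kck_of C f"
  using assms kck_arr_Arr unfolding Arr_kck by blast

lemma Arr_kckI [simp]: "kck_arr C f \<Longrightarrow> kck_of C f \<in> Arr (kck C)"
  unfolding Arr_kck by blast

lemma hom_kckE:
  assumes "x \<in> hom (kck C) X Y"
  obtains f where "kck_arr C f" "f \<in> Arr C" "Dom C f = X" "Cod C f = Y" "x = kck_of C f"
  using assms by (auto simp: hom_def elim: Arr_kckE)

lemma hom_kckI:
  "kck_arr C f \<Longrightarrow> Dom C f = X \<Longrightarrow> Cod C f = Y \<Longrightarrow> kck_of C f \<in> hom (kck C) X Y"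
  by (simp add: hom_def)

end

section \<open>Composition of pairs and the dagger category structure\<close>

context boolean_dagger_kernel_category
begin

text \<open>Each choice of representatives and of a pullback with kernel legs gives a factorisation
  of the same base arrow \<open>g \<cdot> f\<close>. The classes collected by \<open>Comp\<close>
  therefore all coincide.\<close>

lemma kck_of_Comp:
  assumes f: "kck_arr C f" and g: "kck_arr C g" and dc: "Dom C g = Cod C f"
  shows "kck_arr C (g \<cdot> f)" "kck_of C g \<cdot>\<^bsub>kck C\<^esub> kck_of C f = kck_of C (g \<cdot> f)"
proof -
  have *: "kck_pair C (q\<dagger> \<cdot> c) (l \<cdot> p) \<and> (l \<cdot> p) \<cdot> (q\<dagger> \<cdot> c) = g \<cdot> f"
    if ck: "(c, k) \<in> kck_of C f" and dl: "(d, l) \<in> kck_of C g"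
      and pb: "is_pullback C k (d\<dagger>) q p" and p: "is_kernel C p" and q: "is_kernel C q" for c k d l p q
  proof -
    note ck' = kck_of_memD[OF ck] and dl' = kck_of_memD[OF dl]
    note [simp] = kck_pairD[OF ck'(1)] kck_pairD[OF dl'(1)] is_kernel_Arr[OF p] is_kernel_Arr[OF q]
    have kd [simp]: "Dom C d = Cod C k"
      using ck'(4) dl'(3) dc by simp
    have [simp]: "Cod C q = Dom C k" "Cod C p = Dom C l" "Dom C p = Dom C q"
      using pb by (auto simp: is_pullback_def hom_def)
    have "is_kernel C (l \<cdot> p)" "is_kernel C (c\<dagger> \<cdot> q)"
      using p q by (auto intro: is_kernel_Comp)
    then have "kck_pair C (q\<dagger> \<cdot> c) (l \<cdot> p)"
      by (simp add: kck_pair_def is_cokernel_def)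
    \<comment> \<open>Booleanness enters through \<open>Dag_Comp_kernels\<close> for the kernels
      \<open>k\<close> and \<open>d\<dagger>\<close>: its dagger exchanges the middle factors,
      \<open>d \<cdot> k = p \<cdot> q\<dagger>\<close>.\<close>
    have "(k\<dagger> \<cdot> d\<dagger>)\<dagger> = (q \<cdot> p\<dagger>)\<dagger>"
      using Dag_Comp_kernels[OF kck_pairD(6)[OF ck'(1)] kck_pairD(5)[OF dl'(1)] pb q p] by simp
    then have e: "d \<cdot> k = p \<cdot> q\<dagger>"
      by simp
    have "(l \<cdot> p) \<cdot> (q\<dagger> \<cdot> c) = l \<cdot> ((p \<cdot> q\<dagger>) \<cdot> c)"
      by simp
    also have "\<dots> = (l \<cdot> d) \<cdot> (k \<cdot> c)"
      unfolding e[symmetric] by simp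
    finally have "(l \<cdot> p) \<cdot> (q\<dagger> \<cdot> c) = g \<cdot> f"
      unfolding ck'(2) dl'(2) .
    with \<open>kck_pair C (q\<dagger> \<cdot> c) (l \<cdot> p)\<close> show ?thesis by blast
  qed
  let ?Q = "\<lambda>c k d l p q. (c, k) \<in> kck_of C f \<and> (d, l) \<in> kck_of C g
    \<and> is_pullback C k (d\<dagger>) q p \<and> is_kernel C p \<and> is_kernel C q"
  obtain c k where ck: "(c, k) \<in> kck_of C f"
    using kck_of_nonempty[OF f] by fast
  obtain d l where dl: "(d, l) \<in> kck_of C g"
    using kck_of_nonempty[OF g] by fast
  note ck' = kck_of_memD[OF ck] and dl' = kck_of_memD[OF dl]
  have "Cod C k = Cod C (d\<dagger>)"
    using ck'(4) dl'(3) dc kck_pairD(1)[OF dl'(1)] by simp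
  then obtain q p where "is_pullback C k (d\<dagger>) q p" "is_kernel C q" "is_kernel C p"
    using ex_kernel_pullback[OF kck_pairD(6)[OF ck'(1)] kck_pairD(5)[OF dl'(1)]] by blast
  then have Q: "?Q c k d l p q"
    using ck dl by blast
  then show "kck_arr C (g \<cdot> f)"
    using * unfolding kck_arr_def by blast
  have **: "kck_class C (q\<dagger> \<cdot> c) (l \<cdot> p) = kck_of C (g \<cdot> f)" if "?Q c k d l p q" for c k d l p q
    using *[of c k d l q p] kck_class_eq_kck_of[of "q\<dagger> \<cdot> c" "l \<cdot> p"] that by simp
  \<comment> \<open>The admissible choice \<open>Q\<close> keeps this set of classes from being
    empty.\<close>
  have "{kck_class C (q\<dagger> \<cdot> c) (l \<cdot> p) | c k d l p q. ?Q c k d l p q} = {kck_of C (g \<cdot> f)}"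
    (is "?L = _")
  proof
    show "?L \<subseteq> {kck_of C (g \<cdot> f)}"
      using ** by blast
    have "kck_class C (q\<dagger> \<cdot> c) (l \<cdot> p) \<in> ?L"
      using Q by blast
    then show "{kck_of C (g \<cdot> f)} \<subseteq> ?L"
      unfolding **[OF Q] by simp
  qed
  then show "kck_of C g \<cdot>\<^bsub>kck C\<^esub> kck_of C f = kck_of C (g \<cdot> f)"
    by (simp add: kck_def)
qed

text \<open>With these rules \<open>simp\<close> turns an equation in \<open>kck C\<close> into one
  between base arrows.\<close>

lemmas kck_simps [simp] = kck_of_Comp kck_of_Dag Id_kck Id_kck_arr

lemma dagger_category_kck: "dagger_category (kck C)"
proof
  fix x assume "x \<in> Arr (kck C)"
  then show "Dom (kck C) x \<in> Obj (kck C)" "Cod (kck C) x \<in> Obj (kck C)"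
      "(x\<dagger>\<^bsub>kck C\<^esub>)\<dagger>\<^bsub>kck C\<^esub> = x"
    by (auto elim!: Arr_kckE)
next
  fix X assume "X \<in> Obj (kck C)"
  then show "Id (kck C) X \<in> hom (kck C) X X" "(Id (kck C) X)\<dagger>\<^bsub>kck C\<^esub> = Id (kck C) X"
    by (auto simp: hom_def)
next
  fix x y X Y Z
  assume "x \<in> hom (kck C) X Y" "y \<in> hom (kck C) Y Z"
  then show "y \<cdot>\<^bsub>kck C\<^esub> x \<in> hom (kck C) X Z"
      "(y \<cdot>\<^bsub>kck C\<^esub> x)\<dagger>\<^bsub>kck C\<^esub> = x\<dagger>\<^bsub>kck C\<^esub> \<cdot>\<^bsub>kck C\<^esub> y\<dagger>\<^bsub>kck C\<^esub>"
    by (auto elim!: hom_kckE intro!: hom_kckI)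
next
  fix x X Y
  assume "x \<in> hom (kck C) X Y"
  then show "x \<cdot>\<^bsub>kck C\<^esub> Id (kck C) X = x" "Id (kck C) Y \<cdot>\<^bsub>kck C\<^esub> x = x"
      "x\<dagger>\<^bsub>kck C\<^esub> \<in> hom (kck C) Y X"
    by (auto elim!: hom_kckE intro!: hom_kckI)
next
  fix x y z X Y Z W
  assume "x \<in> hom (kck C) X Y" "y \<in> hom (kck C) Y Z" "z \<in> hom (kck C) Z W"
  then show "(z \<cdot>\<^bsub>kck C\<^esub> y) \<cdot>\<^bsub>kck C\<^esub> x = z \<cdot>\<^bsub>kck C\<^esub> (y \<cdot>\<^bsub>kck C\<^esub> x)"
    by (auto elim!: hom_kckE)
qed

interpretation K: dagger_category "kck C"
  by (rule dagger_category_kck)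

section \<open>Zero objects, zero arrows, kernels and Booleanness of the category of pairs\<close>

lemma zero_object_kckI:
  assumes Z: "zero_object C Z"
  shows "zero_object (kck C) Z"
proof -
  have "(\<exists>!x. x \<in> hom (kck C) X Z) \<and> (\<exists>!x. x \<in> hom (kck C) Z X)" if X: "X \<in> Obj C" for X
  proof -
    obtain a b where ab: "a \<in> hom C X Z" "b \<in> hom C Z X"
      by (rule zero_object_homE[OF Z X])
    have "kck_of C a \<in> hom (kck C) X Z" "kck_of C b \<in> hom (kck C) Z X"
      using ab kck_arr_to_zero_object[OF Z, of a] kck_arr_from_zero_object[OF Z, of b]
      by (auto intro!: hom_kckI simp: hom_def[of C])
    moreover have "x = y" if "x \<in> hom (kck C) X Z" "y \<in> hom (kck C) X Z" for x y
      using that zero_arr_unique zero_arr_to_zero_object[OF Z] by (metis hom_kckE)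
    moreover have "x = y" if "x \<in> hom (kck C) Z X" "y \<in> hom (kck C) Z X" for x y
      using that zero_arr_unique zero_arr_from_zero_object[OF Z] by (metis hom_kckE)
    ultimately show ?thesis by blast
  qed
  then show ?thesis
    using Z by (auto simp: zero_object_def)
qed

text \<open>For the direction from \<open>kck C\<close> to \<open>C\<close>, the identity of
  \<open>Z\<close> is the composite of its arrows to and from a base zero object \<open>W\<close>;
  this composite is zero in the base as well.\<close>

lemma zero_object_kck_iff: "zero_object (kck C) Z \<longleftrightarrow> zero_object C Z"
proof
  assume Z: "zero_object (kck C) Z"
  then have Z' [simp]: "Z \<in> Obj C"
    by (simp add: zero_object_def)
  obtain W where W: "zero_object C W"
    using ex_zero_object by blast
  have "W \<in> Obj (kck C)"
    using W by (simp add: zero_object_def)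
  then obtain x y where xy: "x \<in> hom (kck C) W Z" "y \<in> hom (kck C) Z W"
    using K.zero_object_homE[OF Z] by blast
  then have "x \<cdot>\<^bsub>kck C\<^esub> y = Id (kck C) Z"
    using K.zero_arr_from_zero_object[OF Z] K.Comp_hom[OF xy(2,1)] K.Id_hom[of Z]
    by (intro K.zero_arr_unique) (auto simp: hom_def)
  moreover obtain a where a: "kck_arr C a" "a \<in> Arr C" "Dom C a = W" "Cod C a = Z" "x = kck_of C a"
    using xy(1) by (rule hom_kckE)
  moreover obtain b where b: "kck_arr C b" "b \<in> Arr C" "Dom C b = Z" "Cod C b = W" "y = kck_of C b"
    using xy(2) by (rule hom_kckE)
  ultimately have "a \<cdot> b = Id C Z"
    by (simp add: kck_of_inject_iff)
  then have "zero_arr C (Id C Z)"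
    using zero_arrI[OF W b(2,4) a(2,3)] by simp
  then show "zero_object C Z"
    by (rule zero_objectI) simp
qed (rule zero_object_kckI)

lemma zero_arr_kck_iff:
  assumes f: "kck_arr C f"
  shows "zero_arr (kck C) (kck_of C f) \<longleftrightarrow> zero_arr C f"
proof
  assume "zero_arr (kck C) (kck_of C f)"
  then obtain Z x y where Z: "zero_object C Z" and x: "x \<in> Arr (kck C)" "Cod (kck C) x = Z"
      and y: "y \<in> Arr (kck C)" "Dom (kck C) y = Z" and xy: "y \<cdot>\<^bsub>kck C\<^esub> x = kck_of C f"
    by (rule K.zero_arrE) (use zero_object_kck_iff in blast)
  obtain a where a: "kck_arr C a" "a \<in> Arr C" "x = kck_of C a"
    using x(1) by (rule Arr_kckE)
  obtain b where b: "kck_arr C b" "b \<in> Arr C" "y = kck_of C b"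
    using y(1) by (rule Arr_kckE)
  have "b \<cdot> a = f"
    using xy x y a b f by (simp add: kck_of_inject_iff)
  then show "zero_arr C f"
    using zero_arrI[OF Z a(2) _ b(2)] x y a b by simp
next
  assume "zero_arr C f"
  then show "zero_arr (kck C) (kck_of C f)"
  proof (rule zero_arrE)
    fix Z a b
    assume Z: "zero_object C Z" "f \<in> Arr C" "a \<in> Arr C" "Dom C a = Dom C f" "Cod C a = Z"
      "b \<in> Arr C" "Dom C b = Z" "Cod C b = Cod C f" "b \<cdot> a = f"
    have ab: "kck_arr C a" "kck_arr C b"
      using kck_arr_to_zero_object[OF Z(1,3,5)] kck_arr_from_zero_object[OF Z(1,6,7)] by auto
    have "zero_arr (kck C) (kck_of C b \<cdot>\<^bsub>kck C\<^esub> kck_of C a)"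
      using ab Z by (intro K.zero_arrI[OF zero_object_kckI[OF Z(1)]]) auto
    then show ?thesis
      using ab Z by simp
  qed
qed

lemma dagger_mono_kck_iff:
  assumes "kck_arr C f"
  shows "dagger_mono (kck C) (kck_of C f) \<longleftrightarrow> dagger_mono C f"
  using assms kck_arr_Arr[OF assms] by (simp add: dagger_mono_def kck_of_inject_iff)

text \<open>The base factor of \<open>g\<close> through \<open>k\<close> is
  \<open>k\<dagger> \<cdot> g\<close>. If \<open>g\<close> belongs to the subcategory, so does this
  composite, and the base kernel keeps its universal property.\<close>

lemma kernel_of_kckI:
  assumes ko: "kernel_of C k f" and dm: "dagger_mono C k" and f: "kck_arr C f"
  shows "kernel_of (kck C) (kck_of C k) (kck_of C f)"
proof (rule K.kernel_ofI)
  note [simp] = kernel_ofD[OF ko] f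
  have k [simp]: "kck_arr C k"
    using is_kernel_kck_arr kernel_of_is_kernel[OF ko dm] by blast
  show "dagger_mono (kck C) (kck_of C k)"
    using dm dagger_mono_kck_iff by simp
  show "kck_of C f \<in> Arr (kck C)" "Cod (kck C) (kck_of C k) = Dom (kck C) (kck_of C f)"
      "zero_arr (kck C) (kck_of C f \<cdot>\<^bsub>kck C\<^esub> kck_of C k)"
    by (simp_all add: zero_arr_kck_iff)
  fix x assume x: "x \<in> Arr (kck C)" "Cod (kck C) x = Dom (kck C) (kck_of C f)"
    "zero_arr (kck C) (kck_of C f \<cdot>\<^bsub>kck C\<^esub> x)"
  obtain g where g: "kck_arr C g" "g \<in> Arr C" "x = kck_of C g"
    using x(1) by (rule Arr_kckE)
  then have "k \<cdot> (k\<dagger> \<cdot> g) = g"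
    using x by (intro kernel_of_factor[OF ko dm]) (auto simp: zero_arr_kck_iff)
  then show "kck_of C k \<cdot>\<^bsub>kck C\<^esub> (kck_of C k)\<dagger>\<^bsub>kck C\<^esub> \<cdot>\<^bsub>kck C\<^esub> x = x"
    using g x by simp
qed

lemma dagger_kernel_category_kck: "dagger_kernel_category (kck C)"
proof
  show "\<exists>Z. zero_object (kck C) Z"
    using ex_zero_object zero_object_kckI by blast
  fix x assume "x \<in> Arr (kck C)"
  then obtain f where f: "kck_arr C f" "f \<in> Arr C" "x = kck_of C f"
    by (rule Arr_kckE)
  obtain k where k: "kernel_of C k f" "dagger_mono C k"
    using ex_kernel f by blast
  then have "kck_arr C k"
    using is_kernel_kck_arr kernel_of_is_kernel by blast
  then show "\<exists>k. kernel_of (kck C) k x \<and> dagger_mono (kck C) k"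
    using kernel_of_kckI[OF k f(1)] k(2) f(3) dagger_mono_kck_iff by blast
qed

interpretation K: dagger_kernel_category "kck C"
  by (rule dagger_kernel_category_kck)

text \<open>The hypothesis speaks only about test arrows in the subcategory. It is therefore
  compared with a base kernel \<open>l\<close>, which belongs to the subcategory: mutually inverse
  arrows \<open>a\<close> and \<open>b\<close> carry the universal property of \<open>l\<close> over
  to \<open>k\<close>.\<close>

lemma kernel_of_kckD:
  assumes f: "kck_arr C f" and k: "kck_arr C k"
    and ko: "kernel_of (kck C) (kck_of C k) (kck_of C f)"
  shows "kernel_of C k f"
proof -
  note [simp] = f k kck_arr_Arr[OF f] kck_arr_Arr[OF k]
  have kf [simp]: "Cod C k = Dom C f" and fkz: "zero_arr C (f \<cdot> k)"
    using K.kernel_ofD(3,4)[OF ko] by (auto simp: zero_arr_kck_iff)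
  obtain l where l: "kernel_of C l f" and dm [simp]: "dagger_mono C l"
    using ex_kernel[of f] by auto
  note [simp] = kernel_ofD[OF l]
  have [simp]: "kck_arr C l"
    using is_kernel_kck_arr kernel_of_is_kernel[OF l dm] by blast
  define a where "a = l\<dagger> \<cdot> k"
  have [simp]: "a \<in> Arr C" "kck_arr C a" "Dom C a = Dom C k" "Cod C a = Dom C l"
    unfolding a_def by auto
  have la: "l \<cdot> a = k"
    unfolding a_def using kernel_of_factor[OF l dm, of k] fkz by simp
  have kU: "\<exists>!h. h \<in> hom (kck C) (Dom (kck C) g) (Dom C k) \<and> kck_of C k \<cdot>\<^bsub>kck C\<^esub> h = g"
    if "g \<in> Arr (kck C)" "Cod (kck C) g = Dom C f" "zero_arr (kck C) (kck_of C f \<cdot>\<^bsub>kck C\<^esub> g)" for g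
    using ko that unfolding kernel_of_def by simp
  obtain x where x: "x \<in> hom (kck C) (Dom C l) (Dom C k)" "kck_of C k \<cdot>\<^bsub>kck C\<^esub> x = kck_of C l"
    using kU[of "kck_of C l"] by (auto simp: zero_arr_kck_iff)
  obtain b where [simp]: "kck_arr C b" "b \<in> Arr C" "Dom C b = Dom C l" "Cod C b = Dom C k"
    and xb: "x = kck_of C b"
    using x(1) by (rule hom_kckE)
  have kb: "k \<cdot> b = l"
    using x(2) unfolding xb by (simp add: kck_of_inject_iff)
  have "k \<cdot> (b \<cdot> a) = (k \<cdot> b) \<cdot> a"
    by simp
  also have "\<dots> = k"
    unfolding kb by (rule la)
  finally have "kck_of C k \<cdot>\<^bsub>kck C\<^esub> kck_of C (b \<cdot> a) = kck_of C k"
    by simp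
  moreover have "kck_of C k \<cdot>\<^bsub>kck C\<^esub> kck_of C (Id C (Dom C k)) = kck_of C k"
    by simp
  moreover have "kck_of C (b \<cdot> a) \<in> hom (kck C) (Dom C k) (Dom C k)"
      "kck_of C (Id C (Dom C k)) \<in> hom (kck C) (Dom C k) (Dom C k)"
    by (auto intro!: hom_kckI)
  \<comment> \<open>The universal property tested at \<open>k\<close> itself has a single solution,
    which identifies \<open>b \<cdot> a\<close> with the identity. Cancelling \<open>k\<close> in
    \<open>C\<close> is not yet available.\<close>
  moreover have "\<exists>!h. h \<in> hom (kck C) (Dom C k) (Dom C k) \<and> kck_of C k \<cdot>\<^bsub>kck C\<^esub> h = kck_of C k"
    using kU[of "kck_of C k"] fkz by (simp add: zero_arr_kck_iff)
  ultimately have "kck_of C (b \<cdot> a) = kck_of C (Id C (Dom C k))"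
    by blast
  then have ba: "b \<cdot> a = Id C (Dom C k)"
    by (simp add: kck_of_inject_iff)
  have "\<exists>!h. h \<in> hom C (Dom C g) (Dom C k) \<and> k \<cdot> h = g"
    if g: "g \<in> Arr C" "Cod C g = Dom C f" "zero_arr C (f \<cdot> g)" for g
  proof (rule ex1I)
    have "k \<cdot> (b \<cdot> (l\<dagger> \<cdot> g)) = (k \<cdot> b) \<cdot> (l\<dagger> \<cdot> g)"
      using g by simp
    also have "\<dots> = g"
      unfolding kb using kernel_of_factor[OF l dm g] .
    finally show "b \<cdot> (l\<dagger> \<cdot> g) \<in> hom C (Dom C g) (Dom C k) \<and> k \<cdot> (b \<cdot> (l\<dagger> \<cdot> g)) = g"
      using g by (simp add: hom_def)
    fix h assume h: "h \<in> hom C (Dom C g) (Dom C k) \<and> k \<cdot> h = g"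
    then have [simp]: "h \<in> Arr C" "Cod C h = Dom C k" and hg: "k \<cdot> h = g"
      by (auto simp: hom_def)
    have "l\<dagger> \<cdot> g = a \<cdot> h"
      unfolding hg[symmetric] a_def by simp
    then have "b \<cdot> (l\<dagger> \<cdot> g) = (b \<cdot> a) \<cdot> h"
      by simp
    then show "h = b \<cdot> (l\<dagger> \<cdot> g)"
      unfolding ba by simp
  qed
  then show ?thesis
    unfolding kernel_of_def using fkz by simp
qed

lemma is_kernel_kck_iff:
  assumes m: "kck_arr C m"
  shows "is_kernel (kck C) (kck_of C m) \<longleftrightarrow> is_kernel C m"
proof
  assume a: "is_kernel (kck C) (kck_of C m)"
  then obtain x where x: "kernel_of (kck C) (kck_of C m) x"
    unfolding is_kernel_def by blast
  obtain f where f: "kck_arr C f" "x = kck_of C f"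
    using K.kernel_ofD(1)[OF x] by (rule Arr_kckE)
  then have "kernel_of C m f"
    using kernel_of_kckD m x by blast
  then show "is_kernel C m"
    using K.is_kernel_dagger_mono[OF a] m dagger_mono_kck_iff kernel_of_is_kernel by blast
next
  assume a: "is_kernel C m"
  \<comment> \<open>The arrow having \<open>m\<close> as its kernel must lie in the subcategory;
    \<open>(perp C m)\<dagger>\<close> does, being the dagger of a kernel.\<close>
  have "kck_arr C ((perp C m)\<dagger>)"
    using is_kernel_kck_arr[of "perp C m"] is_kernel_Arr[OF a] by simp
  then have "kernel_of (kck C) (kck_of C m) (kck_of C ((perp C m)\<dagger>))"
    using kernel_of_kckI[OF is_kernel_kernel_of_perp[OF a] is_kernel_dagger_mono[OF a]] by blast
  then show "is_kernel (kck C) (kck_of C m)"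
    using K.kernel_of_is_kernel dagger_mono_kck_iff[OF m] is_kernel_dagger_mono[OF a] by blast
qed

lemma is_kernel_kckE:
  assumes "is_kernel (kck C) x"
  obtains m where "is_kernel C m" "kck_arr C m" "m \<in> Arr C" "x = kck_of C m"
  using K.is_kernel_Arr[OF assms] assms is_kernel_kck_iff by (metis Arr_kckE)

text \<open>The given pullback in \<open>kck C\<close> need not be matched with one in the base. It
  suffices that the base pullback square is a cone over it, so its diagonal
  \<open>m \<cdot> p\<close> factors through the zero arrow given by the hypothesis.\<close>

lemma boolean_dagger_kernel_category_kck: "boolean_dagger_kernel_category (kck C)"
proof
  fix x y r s
  assume x: "is_kernel (kck C) x" and y: "is_kernel (kck C) y"
    and xy: "Cod (kck C) x = Cod (kck C) y" and pb: "is_pullback (kck C) x y r s"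
    and z: "zero_arr (kck C) (x \<cdot>\<^bsub>kck C\<^esub> r)"
  obtain m where m: "is_kernel C m" and [simp]: "kck_arr C m" "m \<in> Arr C" and xm: "x = kck_of C m"
    using x by (rule is_kernel_kckE)
  obtain n where n: "is_kernel C n" and [simp]: "kck_arr C n" "n \<in> Arr C" and yn: "y = kck_of C n"
    using y by (rule is_kernel_kckE)
  have [simp]: "Cod C m = Cod C n"
    using xy xm yn by simp
  obtain p q where pq: "is_pullback C m n p q" "is_kernel C p" "is_kernel C q"
    using ex_kernel_pullback[OF m n] by auto
  then have [simp]: "kck_arr C p" "kck_arr C q" "p \<in> Arr C" "q \<in> Arr C"
    using is_kernel_kck_arr is_kernel_Arr by auto
  have [simp]: "Cod C p = Dom C m" "Cod C q = Dom C n" "Dom C q = Dom C p"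
    and sq: "m \<cdot> p = n \<cdot> q"
    using pq by (auto simp: is_pullback_def hom_def)
  have "kck_of C m \<cdot>\<^bsub>kck C\<^esub> kck_of C p = kck_of C n \<cdot>\<^bsub>kck C\<^esub> kck_of C q"
    using sq by simp
  moreover have "kck_of C p \<in> hom (kck C) (Dom C p) (Dom (kck C) x)"
      "kck_of C q \<in> hom (kck C) (Dom C p) (Dom (kck C) y)"
    using xm yn by (auto simp: hom_def)
  ultimately obtain h where h: "h \<in> hom (kck C) (Dom C p) (Dom (kck C) r)"
      "r \<cdot>\<^bsub>kck C\<^esub> h = kck_of C p"
    using pb unfolding is_pullback_def xm yn by blast
  have r: "r \<in> Arr (kck C)" "Cod (kck C) r = Dom (kck C) x"
    using pb unfolding is_pullback_def by auto
  have "zero_arr (kck C) ((x \<cdot>\<^bsub>kck C\<^esub> r) \<cdot>\<^bsub>kck C\<^esub> h)"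
    using h r K.is_kernel_Arr[OF x] by (intro K.zero_arr_comp_right[OF z]) (auto simp: hom_def)
  also have "(x \<cdot>\<^bsub>kck C\<^esub> r) \<cdot>\<^bsub>kck C\<^esub> h = x \<cdot>\<^bsub>kck C\<^esub> (r \<cdot>\<^bsub>kck C\<^esub> h)"
    using h r K.is_kernel_Arr[OF x] by (intro K.assoc) (auto simp: hom_def)
  also have "\<dots> = kck_of C (m \<cdot> p)"
    unfolding h(2) xm by simp
  finally have "zero_arr C (m \<cdot> p)"
    by (simp add: zero_arr_kck_iff)
  then have "zero_arr C (m\<dagger> \<cdot> n)"
    using boolean[OF m n _ pq(1)] by simp
  then show "zero_arr (kck C) (x\<dagger>\<^bsub>kck C\<^esub> \<cdot>\<^bsub>kck C\<^esub> y)"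
    unfolding xm yn by (simp add: zero_arr_kck_iff)
qed

end

section \<open>The functor to the base, kernel posets, the pullback of fibrations, and
  zero-monos\<close>

context boolean_dagger_kernel_category
begin

interpretation K: boolean_dagger_kernel_category "kck C"
  by (rule boolean_dagger_kernel_category_kck)

lemma is_functor_kck_functor: "is_functor (kck C) C (kck_functor C)"
  unfolding is_functor_def using K.category_axioms category_axioms kck_arr_Arr
  by (auto elim!: Arr_kckE simp: hom_def)

lemma dagger_kernel_morphism_kck_functor: "dagger_kernel_morphism (kck C) C (kck_functor C)"
proof -
  have "kernel_of C (FArr (kck_functor C) y) (FArr (kck_functor C) x)"
    if ko: "kernel_of (kck C) y x" for x y
  proof -
    obtain f where f: "kck_arr C f" "x = kck_of C f"
      using K.kernel_ofD(1)[OF ko] by (rule Arr_kckE)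
    obtain k where k: "kck_arr C k" "y = kck_of C k"
      using K.kernel_ofD(2)[OF ko] by (rule Arr_kckE)
    show ?thesis
      using kernel_of_kckD[OF f(1) k(1)] ko f k by simp
  qed
  moreover have "FArr (kck_functor C) (x\<dagger>\<^bsub>kck C\<^esub>) = (FArr (kck_functor C) x)\<dagger>"
    if "x \<in> Arr (kck C)" for x
    using that by (auto elim!: Arr_kckE)
  ultimately show ?thesis
    unfolding dagger_kernel_morphism_def
    using K.dagger_kernel_category_axioms dagger_kernel_category_axioms is_functor_kck_functor
      zero_object_kck_iff by simp
qed

text \<open>Kernels agree on both sides, and so do the equations between projections that define
  their classes; hence classes correspond element by element.\<close>

lemma ksub_class_kck:
  assumes m: "is_kernel C m"
  shows "ksub_class (kck C) (kck_of C m) = kck_of C ` ksub_class C m"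
proof -
  note m' [simp] = is_kernel_kck_arr[OF m] is_kernel_Arr[OF m]
  have mK: "is_kernel (kck C) (kck_of C m)"
    using m is_kernel_kck_iff by simp
  have *: "kck_of C n \<in> ksub_class (kck C) (kck_of C m) \<longleftrightarrow> n \<in> ksub_class C m"
    if n: "is_kernel C n" for n
    using is_kernel_kck_arr[OF n] is_kernel_Arr[OF n] n
    by (simp add: K.ksub_class_iff[OF mK] ksub_class_iff[OF m] is_kernel_kck_iff kck_of_inject_iff)
  show ?thesis
  proof
    show "ksub_class (kck C) (kck_of C m) \<subseteq> kck_of C ` ksub_class C m"
    proof
      fix x assume x: "x \<in> ksub_class (kck C) (kck_of C m)"
      then have "is_kernel (kck C) x"
        using K.ksub_class_iff[OF mK] by blast
      then obtain n where "is_kernel C n" "x = kck_of C n"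
        by (rule is_kernel_kckE)
      then show "x \<in> kck_of C ` ksub_class C m"
        using x * by blast
    qed
    show "kck_of C ` ksub_class C m \<subseteq> ksub_class (kck C) (kck_of C m)"
      using * ksub_class_iff[OF m] by blast
  qed
qed

lemma KSub_kck: "KSub (kck C) X = (`) (kck_of C) ` KSub C X"
proof
  show "KSub (kck C) X \<subseteq> (`) (kck_of C) ` KSub C X"
  proof
    fix A assume "A \<in> KSub (kck C) X"
    then obtain x where x: "is_kernel (kck C) x" "Cod (kck C) x = X" "A = ksub_class (kck C) x"
      by (rule K.KSubE)
    obtain m where m: "is_kernel C m" "kck_arr C m" "x = kck_of C m"
      using x(1) by (rule is_kernel_kckE)
    then have "A = kck_of C ` ksub_class C m" "ksub_class C m \<in> KSub C X"
      using x ksub_class_kck by (auto intro: KSubI)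
    then show "A \<in> (`) (kck_of C) ` KSub C X"
      by blast
  qed
  show "(`) (kck_of C) ` KSub C X \<subseteq> KSub (kck C) X"
  proof (rule image_subsetI)
    fix A assume "A \<in> KSub C X"
    then obtain m where m: "is_kernel C m" "Cod C m = X" "A = ksub_class C m"
      by (rule KSubE)
    then have "kck_of C ` A = ksub_class (kck C) (kck_of C m)"
      using ksub_class_kck by simp
    moreover have "ksub_class (kck C) (kck_of C m) \<in> KSub (kck C) X"
      using m is_kernel_kck_arr[OF m(1)] is_kernel_kck_iff by (intro K.KSubI) auto
    ultimately show "kck_of C ` A \<in> KSub (kck C) X"
      by simp
  qed
qed

text \<open>\<open>ksub_map\<close> is a union over all representatives; each of them contributes
  the whole class \<open>A\<close>.\<close>

lemma ksub_map_kck: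
  assumes A: "A \<in> KSub C X"
  shows "ksub_map C (kck_functor C) (kck_of C ` A) = A"
proof -
  have "ksub_class C (FArr (kck_functor C) (kck_of C m)) = A" if "m \<in> A" for m
    using KSub_kernel[OF A that] KSub_eq_ksub_class[OF A that] is_kernel_kck_arr by simp
  then show ?thesis
    using KSub_nonempty[OF A] by (auto simp: ksub_map_def)
qed

lemma bij_betw_ksub_map: "bij_betw (ksub_map C (kck_functor C)) (KSub (kck C) X) (KSub C X)"
  by (rule bij_betw_byWitness[of _ "(`) (kck_of C)"]) (auto simp: KSub_kck ksub_map_kck)

text \<open>Tested at corresponding representatives, both sides become the same equation, once in
  \<open>kck C\<close> and once in \<open>C\<close>. This transfers both the order of kernels and
  the arrows of the fibration.\<close>

lemma fib_rel_kck_iff: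
  assumes A: "A \<in> KSub C X" and B: "B \<in> KSub C Y" and f: "f \<in> hom C X Y" "kck_arr C f"
  shows "fib_rel (kck C) (kck_of C f) (kck_of C ` A) (kck_of C ` B) \<longleftrightarrow> fib_rel C f A B"
proof -
  obtain m n where m: "m \<in> A" and n: "n \<in> B"
    using KSub_nonempty[OF A] KSub_nonempty[OF B] by blast
  have [simp]: "kck_arr C m" "m \<in> Arr C" "Cod C m = X" "kck_arr C n" "n \<in> Arr C" "Cod C n = Y"
    using KSub_kernel[OF A m] KSub_kernel[OF B n] is_kernel_kck_arr is_kernel_Arr by auto
  have [simp]: "f \<in> Arr C" "Dom C f = X" "Cod C f = Y" "kck_arr C f"
    using f by (auto simp: hom_def)
  have "kck_of C ` A \<in> KSub (kck C) X" "kck_of C ` B \<in> KSub (kck C) Y"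
    using A B KSub_kck by auto
  then show ?thesis
    using K.fib_rel_iff[of "kck_of C ` A" X "kck_of C m" "kck_of C ` B" Y "kck_of C n" "kck_of C f"]
      fib_rel_iff[OF A m B n f(1)] m n hom_kckI[of f X Y]
    by (simp add: kck_of_inject_iff)
qed

lemma order_iso_KSub_kck:
  "order_iso (KSub (kck C) X) (ksub_le (kck C)) (KSub C X) (ksub_le C) (ksub_map C (kck_functor C))"
proof -
  have "ksub_le (kck C) (kck_of C ` A) (kck_of C ` B) \<longleftrightarrow> ksub_le C A B"
    if A: "A \<in> KSub C X" and B: "B \<in> KSub C X" for A B
  proof -
    have X: "X \<in> Obj C"
      using KSub_Obj[OF A] .
    have "kck_of C ` A \<in> KSub (kck C) X"
      using A KSub_kck by auto
    then show ?thesis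
      using K.ksub_le_fib_rel[of "kck_of C ` A" X "kck_of C ` B"] ksub_le_fib_rel[OF A, of B]
        fib_rel_kck_iff[OF A B Id_hom[OF X] Id_kck_arr[OF X]] X by simp
  qed
  then show ?thesis
    unfolding order_iso_def using bij_betw_ksub_map by (auto simp: KSub_kck ksub_map_kck)
qed

lemma Arr_kernel_fibration_kckE:
  assumes "t \<in> Arr (kernel_fibration (kck C))"
  obtains X A f Y B where "t = ((X, kck_of C ` A), kck_of C f, (Y, kck_of C ` B))"
    "A \<in> KSub C X" "B \<in> KSub C Y" "f \<in> hom C X Y" "kck_arr C f" "fib_rel C f A B"
  using assms
proof (rule K.kernel_fibration_ArrE)
  fix X A' x Y B'
  assume t: "t = ((X, A'), x, (Y, B'))" "A' \<in> KSub (kck C) X" "B' \<in> KSub (kck C) Y"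
    "x \<in> hom (kck C) X Y" "fib_rel (kck C) x A' B'"
  obtain A B where A: "A \<in> KSub C X" "A' = kck_of C ` A" and B: "B \<in> KSub C Y" "B' = kck_of C ` B"
    using t(2,3) KSub_kck by auto
  obtain f where f: "kck_arr C f" "f \<in> Arr C" "Dom C f = X" "Cod C f = Y" "x = kck_of C f"
    using t(4) by (rule hom_kckE)
  then have f': "f \<in> hom C X Y"
    by (simp add: hom_def)
  show thesis
    using t A B f f' fib_rel_kck_iff[OF A(1) B(1) f' f(1)] by (intro that[of X A f Y B]) auto
qed

lemma Arr_kernel_fibration_kckI:
  assumes "A \<in> KSub C X" "B \<in> KSub C Y" "f \<in> hom C X Y" "kck_arr C f" "fib_rel C f A B"
  shows "((X, kck_of C ` A), kck_of C f, (Y, kck_of C ` B)) \<in> Arr (kernel_fibration (kck C))"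
  using assms fib_rel_kck_iff[OF assms(1-4)] KSub_kck hom_kckI[of f X Y]
  by (intro K.kernel_fibration_ArrI) (auto simp: hom_def)

lemma kernel_fibration_map_simps:
  "FObj (kernel_fibration_map C F) (X, A) = (FObj F X, ksub_map C F A)"
  "FArr (kernel_fibration_map C F) ((X, A), f, (Y, B))
    = ((FObj F X, ksub_map C F A), FArr F f, (FObj F Y, ksub_map C F B))"
  by (simp_all add: kernel_fibration_map_def Let_def)

lemma is_functor_kernel_fibration_map_kck:
  "is_functor (kernel_fibration (kck C)) (kernel_fibration C) (kernel_fibration_map C (kck_functor C))"
  unfolding is_functor_def
proof (intro conjI ballI impI)
  fix a assume "a \<in> Obj (kernel_fibration (kck C))"
  then obtain X A where a: "a = (X, kck_of C ` A)" "A \<in> KSub C X"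
    by (auto simp: K.kernel_fibration_simps KSub_kck)
  then show "FObj (kernel_fibration_map C (kck_functor C)) a \<in> Obj (kernel_fibration C)"
    by (simp add: kernel_fibration_map_simps ksub_map_kck kernel_fibration_simps)
  show "FArr (kernel_fibration_map C (kck_functor C)) (Id (kernel_fibration (kck C)) a)
      = Id (kernel_fibration C) (FObj (kernel_fibration_map C (kck_functor C)) a)"
    using a KSub_Obj[OF a(2)]
    by (simp add: kernel_fibration_map_simps ksub_map_kck kernel_fibration_simps
        K.kernel_fibration_simps)
next
  fix t assume "t \<in> Arr (kernel_fibration (kck C))"
  then obtain X A f Y B where t: "t = ((X, kck_of C ` A), kck_of C f, (Y, kck_of C ` B))"
    "A \<in> KSub C X" "B \<in> KSub C Y" "f \<in> hom C X Y" "kck_arr C f" "fib_rel C f A B"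
    by (rule Arr_kernel_fibration_kckE)
  then show "FArr (kernel_fibration_map C (kck_functor C)) t \<in> hom (kernel_fibration C)
      (FObj (kernel_fibration_map C (kck_functor C)) (Dom (kernel_fibration (kck C)) t))
      (FObj (kernel_fibration_map C (kck_functor C)) (Cod (kernel_fibration (kck C)) t))"
    by (simp add: kernel_fibration_map_simps ksub_map_kck kernel_fibration_simps
        K.kernel_fibration_simps hom_def[of "kernel_fibration C"])
next
  fix s t
  assume s: "s \<in> Arr (kernel_fibration (kck C))" and t: "t \<in> Arr (kernel_fibration (kck C))"
    and dc: "Dom (kernel_fibration (kck C)) t = Cod (kernel_fibration (kck C)) s"
  obtain X A f Y B where s': "s = ((X, kck_of C ` A), kck_of C f, (Y, kck_of C ` B))"
      "f \<in> hom C X Y" "kck_arr C f"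
    using s by (rule Arr_kernel_fibration_kckE)
  obtain Y' B' g Z D where t': "t = ((Y', kck_of C ` B'), kck_of C g, (Z, kck_of C ` D))"
      "g \<in> hom C Y' Z" "kck_arr C g"
    using t by (rule Arr_kernel_fibration_kckE)
  have "Dom C g = Cod C f"
    using dc s' t' by (simp add: K.kernel_fibration_simps hom_def)
  then show "FArr (kernel_fibration_map C (kck_functor C)) (t \<cdot>\<^bsub>kernel_fibration (kck C)\<^esub> s)
      = FArr (kernel_fibration_map C (kck_functor C)) t
        \<cdot>\<^bsub>kernel_fibration C\<^esub> FArr (kernel_fibration_map C (kck_functor C)) s"
    using s' t' by (simp add: kernel_fibration_map_simps kernel_fibration_simps
        K.kernel_fibration_simps)
qed (rule K.category_kernel_fibration category_kernel_fibration)+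

text \<open>An arrow of the fibre product is an arrow of \<open>kck C\<close> together with an arrow
  of the base fibration over the same \<open>f\<close>. Its two kernel classes lift uniquely to
  \<open>kck C\<close>, and \<open>fib_rel_kck_iff\<close> lifts the factorisation
  condition.\<close>

lemma cat_pullback_square_kck:
  "cat_pullback_square (kernel_fibration (kck C)) (kck C) (kernel_fibration C) C
     kernel_fibration_proj (kernel_fibration_map C (kck_functor C))
     (kck_functor C) kernel_fibration_proj"
  unfolding cat_pullback_square_def
proof (intro conjI)
  let ?P = "kernel_fibration (kck C)" and ?M = "kernel_fibration_map C (kck_functor C)"
  show "functor_eq ?P (functor_comp (kck_functor C) kernel_fibration_proj)
      (functor_comp kernel_fibration_proj ?M)"
    unfolding functor_eq_def functor_comp_def
    by (auto simp: kernel_fibration_proj_def kernel_fibration_map_simps K.kernel_fibration_simps)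
  show "bij_betw (\<lambda>x. (FObj kernel_fibration_proj x, FObj ?M x)) (Obj ?P)
      {(a, b). a \<in> Obj (kck C) \<and> b \<in> Obj (kernel_fibration C)
        \<and> FObj (kck_functor C) a = FObj kernel_fibration_proj b}"
    by (rule bij_betw_byWitness[of _ "\<lambda>(X, Y, A). (X, kck_of C ` A)"])
      (auto simp: K.kernel_fibration_simps kernel_fibration_simps KSub_kck ksub_map_kck
        kernel_fibration_proj_def kernel_fibration_map_simps KSub_Obj)
  \<comment> \<open>The candidate inverse takes the middle arrow from the \<open>kck C\<close>
    component and lifts both kernel classes.\<close>
  let ?inv = "\<lambda>(x, (X, A), f, (Y, B)). ((X, kck_of C ` A), x, (Y, kck_of C ` B))"
  let ?T = "{(f, g). f \<in> Arr (kck C) \<and> g \<in> Arr (kernel_fibration C)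
        \<and> FArr (kck_functor C) f = FArr kernel_fibration_proj g}"
  \<comment> \<open>Normal form in the fibre product: the \<open>kck C\<close> component is
    recovered from the base arrow \<open>f\<close> as \<open>kck_of C f\<close>.\<close>
  have T: "\<exists>X A f Y B. u = (kck_of C f, (X, A), f, (Y, B)) \<and> A \<in> KSub C X \<and> B \<in> KSub C Y
      \<and> f \<in> hom C X Y \<and> kck_arr C f \<and> fib_rel C f A B" if "u \<in> ?T" for u
    using that by (auto elim!: Arr_kckE kernel_fibration_ArrE simp: kernel_fibration_proj_def)
  show "bij_betw (\<lambda>x. (FArr kernel_fibration_proj x, FArr ?M x)) (Arr ?P) ?T"
  proof (rule bij_betw_byWitness[of _ ?inv])
    show "\<forall>t\<in>Arr ?P. ?inv (FArr kernel_fibration_proj t, FArr ?M t) = t"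
      by (auto elim!: Arr_kernel_fibration_kckE
          simp: kernel_fibration_proj_def kernel_fibration_map_simps ksub_map_kck)
    show "\<forall>u\<in>?T. (FArr kernel_fibration_proj (?inv u), FArr ?M (?inv u)) = u"
    proof
      fix u assume "u \<in> ?T"
      from T[OF this] show "(FArr kernel_fibration_proj (?inv u), FArr ?M (?inv u)) = u"
        by (auto simp: kernel_fibration_proj_def kernel_fibration_map_simps ksub_map_kck)
    qed
    show "(\<lambda>x. (FArr kernel_fibration_proj x, FArr ?M x)) ` Arr ?P \<subseteq> ?T"
      by (auto elim!: Arr_kernel_fibration_kckE intro!: kernel_fibration_ArrI
          simp: kernel_fibration_proj_def kernel_fibration_map_simps ksub_map_kck)
    show "?inv ` ?T \<subseteq> Arr ?P"
    proof (rule image_subsetI)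
      fix u assume "u \<in> ?T"
      from T[OF this] show "?inv u \<in> Arr ?P"
        by (auto intro!: Arr_kernel_fibration_kckI)
    qed
  qed
qed (rule K.is_functor_kernel_fibration_proj is_functor_kernel_fibration_proj
    is_functor_kernel_fibration_map_kck is_functor_kck_functor)+

text \<open>The kernel \<open>n\<close> of \<open>c\<close> belongs to the subcategory, so it may be
  used as a test arrow. It is annihilated by \<open>k \<cdot> c\<close>, hence zero; so
  \<open>c\<dagger>\<close> has zero complement, and \<open>c\<close> is unitary.\<close>

lemma kck_zero_mono_is_kernel:
  assumes x: "zero_mono (kck C) x"
  shows "is_kernel (kck C) x"
proof -
  have "x \<in> Arr (kck C)"
    using x by (simp add: zero_mono_def)
  then obtain m where m: "kck_arr C m" "x = kck_of C m"
    by (rule Arr_kckE)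
  obtain c k where ck: "kck_pair C c k" and kc: "k \<cdot> c = m"
    using m(1) unfolding kck_arr_def by blast
  note [simp] = kck_pairD[OF ck]
  have dm: "Dom C m = Dom C c"
    using kc by auto
  \<comment> \<open>Since the dagger is involutive, the complement of \<open>c\<dagger>\<close> is
    the kernel of \<open>c\<close>.\<close>
  define n where "n = perp C (c\<dagger>)"
  have n [simp]: "n \<in> Arr C" "Cod C n = Dom C c" "is_kernel C n"
    unfolding n_def by auto
  have nk [simp]: "kck_arr C n"
    using is_kernel_kck_arr by simp
  have cn: "zero_arr C (c \<cdot> n)"
    using zero_arr_perp(1)[of "c\<dagger>"] unfolding n_def by simp
  have "zero_arr C (k \<cdot> (c \<cdot> n))"
    by (rule zero_arr_comp_left[OF cn]) simp_all
  then have "zero_arr C (m \<cdot> n)"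
    unfolding kc[symmetric] by simp
  then have "zero_arr (kck C) (x \<cdot>\<^bsub>kck C\<^esub> kck_of C n)"
    unfolding m(2) using m(1) dm by (simp add: zero_arr_kck_iff)
  then have "zero_arr (kck C) (kck_of C n)"
    using x m dm unfolding zero_mono_def by simp
  then have "zero_arr C (n\<dagger>)"
    using zero_arr_Dag by (simp add: zero_arr_kck_iff)
  \<comment> \<open>The inserted identity is the arrow to be factored through
    \<open>c\<dagger>\<close>.\<close>
  then have "zero_arr C ((perp C (c\<dagger>))\<dagger> \<cdot> Id C (Dom C c))"
    unfolding n_def[symmetric] by simp
  then have "c\<dagger> \<cdot> c = Id C (Dom C c)"
    using is_kernel_factor[of "c\<dagger>" "Id C (Dom C c)"] by simp
  then have "is_kernel C c"
    using cokernel_simps(1)[OF ck] by (intro unitary_is_kernel) auto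
  then have "is_kernel C m"
    unfolding kc[symmetric] by (intro is_kernel_Comp) auto
  then show ?thesis
    using m is_kernel_kck_iff by simp
qed

end

section \<open>Monos and the universal property\<close>

lemma (in dagger_category) dagger_mono_mono_arr: "dagger_mono C m \<Longrightarrow> mono_arr C m"
  unfolding mono_arr_def using dagger_mono_cancel[of m] dagger_mono_Arr[of m]
  by (auto simp: hom_def)

text \<open>For a zero arrow \<open>z\<close> parallel to \<open>f\<close>, both
  \<open>m \<cdot> f\<close> and \<open>m \<cdot> z\<close> are zero and thus equal; cancelling
  \<open>m\<close> leaves \<open>f = z\<close>.\<close>

lemma (in dagger_kernel_category) mono_arr_zero_mono:
  assumes m: "mono_arr C m"
  shows "zero_mono C m"
  unfolding zero_mono_def
proof (intro conjI ballI impI)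
  show mA: "m \<in> Arr C"
    using m by (simp add: mono_arr_def)
  fix f assume f: "f \<in> Arr C" and a: "Cod C f = Dom C m \<and> zero_arr C (m \<cdot> f)"
  obtain z where z: "zero_arr C z" "Dom C z = Dom C f" "Cod C z = Dom C m"
    using ex_zero_arr[of "Dom C f" "Dom C m"] f mA by auto
  then have zA: "z \<in> Arr C"
    using zero_arr_Arr by blast
  have "m \<cdot> z = m \<cdot> f"
    using zero_arr_comp_left[OF z(1) mA] a z zA f mA by (intro zero_arr_unique) auto
  then have "z = f"
    using m zA z f a unfolding mono_arr_def hom_def by auto
  then show "zero_arr C f"
    using z(1) by simp
qed

text \<open>Splitting off the coimage: the restriction of \<open>f\<close> to the complement of its kernel is a
  zero-mono.\<close>

lemma (in dagger_kernel_category) zero_monos_kernels_kck_arr: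
  assumes zk: "\<And>m. zero_mono C m \<Longrightarrow> is_kernel C m" and f: "f \<in> Arr C"
  shows "kck_arr C f"
proof -
  note [simp] = f
  obtain n where ko: "kernel_of C n f" and dm: "dagger_mono C n"
    using ex_kernel[OF f] by blast
  note [simp] = kernel_ofD[OF ko]
  define r where "r = perp C n"
  have [simp]: "r \<in> Arr C" "Cod C r = Dom C f" "is_kernel C r" "dagger_mono C r"
    unfolding r_def by auto
  \<comment> \<open>As \<open>f\<close> annihilates \<open>n\<close>, its dagger lies in the
    complement \<open>r\<close>; taking daggers again shows that \<open>f\<close> is unchanged by
    the projection onto \<open>r\<close>.\<close>
  have "zero_arr C (n\<dagger> \<cdot> f\<dagger>)"
    using zero_arr_Dag[OF kernel_ofD(4)[OF ko]] by simp
  then have "r \<cdot> (r\<dagger> \<cdot> f\<dagger>) = f\<dagger>"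
    unfolding r_def by (intro perp_factor) auto
  then have "(r \<cdot> (r\<dagger> \<cdot> f\<dagger>))\<dagger> = (f\<dagger>)\<dagger>"
    by (rule arg_cong)
  then have e: "(f \<cdot> r) \<cdot> r\<dagger> = f"
    by simp
  have "zero_mono C (f \<cdot> r)"
    unfolding zero_mono_def
  proof (intro conjI ballI impI)
    fix g assume g: "g \<in> Arr C" and a: "Cod C g = Dom C (f \<cdot> r) \<and> zero_arr C ((f \<cdot> r) \<cdot> g)"
    then have [simp]: "Cod C g = Dom C r"
      by simp
    \<comment> \<open>If \<open>f \<cdot> r\<close> annihilates \<open>g\<close>, then
      \<open>r \<cdot> g\<close> lies in the kernel \<open>n\<close>, to which \<open>r\<close> is
      orthogonal; so \<open>g\<close>, recovered by applying \<open>r\<dagger>\<close>, is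
      zero.\<close>
    have "n \<cdot> (n\<dagger> \<cdot> (r \<cdot> g)) = r \<cdot> g"
      using kernel_of_factor[OF ko dm, of "r \<cdot> g"] g a by simp
    then have "r\<dagger> \<cdot> (n \<cdot> (n\<dagger> \<cdot> (r \<cdot> g))) = g"
      using g by simp
    moreover have "zero_arr C ((r\<dagger> \<cdot> n) \<cdot> (n\<dagger> \<cdot> (r \<cdot> g)))"
      using g by (intro zero_arr_comp_right[OF zero_arr_perp(2)[of n, folded r_def]]) auto
    ultimately show "zero_arr C g"
      using g by simp
  qed simp
  then have "is_kernel C (f \<cdot> r)"
    by (rule zk)
  then have "kck_pair C (r\<dagger>) (f \<cdot> r)"
    by (simp add: kck_pair_def is_cokernel_def)
  then show ?thesis
    using e unfolding kck_arr_def by blast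
qed

text \<open>Preservation of kernels is part of the definition of a morphism; being dagger mono is an
  equation in dagger, composition and identities, so it is preserved as well.\<close>

lemma dagger_kernel_morphism_is_kernel:
  assumes F: "dagger_kernel_morphism E D F" and k: "is_kernel E k"
  shows "is_kernel D (FArr F k)"
proof -
  interpret E: dagger_kernel_category E
    using F by (simp add: dagger_kernel_morphism_def)
  obtain f where f: "kernel_of E k f"
    using k unfolding is_kernel_def by blast
  note kA [simp] = E.is_kernel_Arr[OF k]
  have "kernel_of D (FArr F k) (FArr F f)"
    using F f unfolding dagger_kernel_morphism_def by blast
  moreover have "FArr F (k\<dagger>\<^bsub>E\<^esub> \<cdot>\<^bsub>E\<^esub> k) = (FArr F k)\<dagger>\<^bsub>D\<^esub> \<cdot>\<^bsub>D\<^esub> FArr F k"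
    using F unfolding dagger_kernel_morphism_def is_functor_def by simp
  moreover have "FArr F (Id E (Dom E k)) = Id D (FObj F (Dom E k))"
      "FArr F k \<in> hom D (FObj F (Dom E k)) (FObj F (Cod E k))"
    using F unfolding dagger_kernel_morphism_def is_functor_def by simp_all
  ultimately show ?thesis
    using E.is_kernel_dagger_mono[OF k] unfolding is_kernel_def dagger_mono_def
    by (auto simp: hom_def)
qed

lemma dagger_kernel_morphism_kck_arr:
  assumes F: "dagger_kernel_morphism E D F" and f: "kck_arr E f"
  shows "kck_arr D (FArr F f)"
proof -
  interpret E: dagger_kernel_category E
    using F by (simp add: dagger_kernel_morphism_def)
  obtain c k where ck: "kck_pair E c k" and e: "k \<cdot>\<^bsub>E\<^esub> c = f"
    using f unfolding kck_arr_def by blast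
  note [simp] = E.kck_pairD[OF ck]
  have "FArr F (k \<cdot>\<^bsub>E\<^esub> c) = FArr F k \<cdot>\<^bsub>D\<^esub> FArr F c"
      "FArr F c \<in> hom D (FObj F (Dom E c)) (FObj F (Cod E c))"
      "FArr F k \<in> hom D (FObj F (Dom E k)) (FObj F (Cod E k))"
      "FArr F (c\<dagger>\<^bsub>E\<^esub>) = (FArr F c)\<dagger>\<^bsub>D\<^esub>"
    using F E.kck_pairD(1,2)[OF ck] E.kck_pairD(7)[OF ck, symmetric]
    unfolding dagger_kernel_morphism_def is_functor_def by blast+
  moreover have "is_kernel D (FArr F k)" "is_kernel D (FArr F (c\<dagger>\<^bsub>E\<^esub>))"
    using dagger_kernel_morphism_is_kernel[OF F] by auto
  ultimately have "kck_pair D (FArr F c) (FArr F k)" "FArr F k \<cdot>\<^bsub>D\<^esub> FArr F c = FArr F f"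
    using e by (auto simp: kck_pair_def is_cokernel_def hom_def)
  then show ?thesis
    unfolding kck_arr_def by blast
qed

text \<open>All arrows of \<open>E\<close> have cokernel-kernel factorisations, so \<open>F\<close>
  takes values in the subcategory. There an arrow is determined by its underlying base arrow, which
  leaves only one possible lift.\<close>

lemma (in boolean_dagger_kernel_category) kck_universal:
  assumes E: "dagger_kernel_category E" and zk: "\<And>m. zero_mono E m \<Longrightarrow> is_kernel E m"
    and F: "dagger_kernel_morphism E C F"
  shows "\<exists>G. is_functor E (kck C) G \<and> functor_eq E (functor_comp (kck_functor C) G) F
    \<and> (\<forall>G'. is_functor E (kck C) G' \<and> functor_eq E (functor_comp (kck_functor C) G') F
        \<longrightarrow> functor_eq E G' G)"
proof -
  interpret E: dagger_kernel_category E
    by (rule E)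
  interpret K: dagger_category "kck C"
    by (rule dagger_category_kck)
  have ka: "kck_arr C (FArr F f)" if "f \<in> Arr E" for f
    using dagger_kernel_morphism_kck_arr[OF F] E.zero_monos_kernels_kck_arr[OF zk that] by blast
  have Ff: "FArr F f \<in> Arr C" "Dom C (FArr F f) = FObj F (Dom E f)"
      "Cod C (FArr F f) = FObj F (Cod E f)" if "f \<in> Arr E" for f
    using F that unfolding dagger_kernel_morphism_def is_functor_def by (auto simp: hom_def)
  have FId: "FObj F X \<in> Obj C" "FArr F (Id E X) = Id C (FObj F X)" if "X \<in> Obj E" for X
    using F that unfolding dagger_kernel_morphism_def is_functor_def by auto
  have FC: "FArr F (g \<cdot>\<^bsub>E\<^esub> f) = FArr F g \<cdot> FArr F f"
    if "f \<in> Arr E" "g \<in> Arr E" "Dom E g = Cod E f" for f g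
    using F that unfolding dagger_kernel_morphism_def is_functor_def by auto
  define G where "G = \<lparr>FObj = FObj F, FArr = (\<lambda>f. kck_of C (FArr F f))\<rparr>"
  have "is_functor E (kck C) G"
    unfolding is_functor_def G_def using E.category_axioms K.category_axioms
    by (auto simp: ka Ff FId FC intro!: hom_kckI)
  moreover have "functor_eq E (functor_comp (kck_functor C) G) F"
    unfolding functor_eq_def functor_comp_def G_def by (simp add: ka)
  moreover have "functor_eq E G' G"
    if G': "is_functor E (kck C) G'" "functor_eq E (functor_comp (kck_functor C) G') F" for G'
  proof -
    have "FArr G' f = kck_of C (FArr F f)" if f: "f \<in> Arr E" for f
    proof -
      have "FArr G' f \<in> Arr (kck C)"
        using G'(1) f unfolding is_functor_def hom_def by blast
      then obtain h where h: "kck_arr C h" "FArr G' f = kck_of C h"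
        by (rule Arr_kckE)
      then show ?thesis
        using G'(2) f unfolding functor_eq_def functor_comp_def by auto
    qed
    then show ?thesis
      using G'(2) unfolding functor_eq_def functor_comp_def G_def by simp
  qed
  ultimately show ?thesis by blast
qed

theorem theorem6p6:
  fixes D :: "('o, 'a) dagger_cat"
  assumes "boolean_dagger_kernel_category D"
  shows "boolean_dagger_kernel_category (kck D)
    \<and> dagger_kernel_morphism (kck D) D (kck_functor D)
    \<and> (\<forall>X \<in> Obj (kck D). order_iso (KSub (kck D) X) (ksub_le (kck D))
         (KSub D (FObj (kck_functor D) X)) (ksub_le D) (ksub_map D (kck_functor D)))
    \<and> cat_pullback_square (kernel_fibration (kck D)) (kck D) (kernel_fibration D) D
         kernel_fibration_proj (kernel_fibration_map D (kck_functor D))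
         (kck_functor D) kernel_fibration_proj
    \<and> {m. is_kernel (kck D) m} = {m. dagger_mono (kck D) m}
    \<and> {m. dagger_mono (kck D) m} = {m. mono_arr (kck D) m}
    \<and> {m. mono_arr (kck D) m} = {m. zero_mono (kck D) m}
    \<and> (\<forall>(E :: ('p, 'b) dagger_cat) F.
         boolean_dagger_kernel_category E \<and> (\<forall>m. zero_mono E m \<longrightarrow> is_kernel E m)
           \<and> dagger_kernel_morphism E D F
         \<longrightarrow> (\<exists>G. is_functor E (kck D) G \<and> functor_eq E (functor_comp (kck_functor D) G) F
               \<and> (\<forall>G'. is_functor E (kck D) G'
                     \<and> functor_eq E (functor_comp (kck_functor D) G') F
                   \<longrightarrow> functor_eq E G' G)))"
proof -
  interpret D: boolean_dagger_kernel_category D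
    by (rule assms)
  interpret K: boolean_dagger_kernel_category "kck D"
    by (rule D.boolean_dagger_kernel_category_kck)
  \<comment> \<open>The inclusion of zero-monos in kernels closes the cycle, so all four classes are
    equal.\<close>
  have "{m. is_kernel (kck D) m} \<subseteq> {m. dagger_mono (kck D) m}"
      "{m. dagger_mono (kck D) m} \<subseteq> {m. mono_arr (kck D) m}"
      "{m. mono_arr (kck D) m} \<subseteq> {m. zero_mono (kck D) m}"
      "{m. zero_mono (kck D) m} \<subseteq> {m. is_kernel (kck D) m}"
    using K.is_kernel_dagger_mono K.dagger_mono_mono_arr K.mono_arr_zero_mono
      D.kck_zero_mono_is_kernel by blast+
  then have classes: "{m. is_kernel (kck D) m} = {m. dagger_mono (kck D) m}"
      "{m. dagger_mono (kck D) m} = {m. mono_arr (kck D) m}"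
      "{m. mono_arr (kck D) m} = {m. zero_mono (kck D) m}"
    by blast+
  show ?thesis
  proof (intro conjI ballI allI impI)
    fix X
    show "order_iso (KSub (kck D) X) (ksub_le (kck D))
         (KSub D (FObj (kck_functor D) X)) (ksub_le D) (ksub_map D (kck_functor D))"
      using D.order_iso_KSub_kck by simp
  next
    fix E :: "('p, 'b) dagger_cat" and F
    assume "boolean_dagger_kernel_category E \<and> (\<forall>m. zero_mono E m \<longrightarrow> is_kernel E m)
      \<and> dagger_kernel_morphism E D F"
    then show "\<exists>G. is_functor E (kck D) G \<and> functor_eq E (functor_comp (kck_functor D) G) F
        \<and> (\<forall>G'. is_functor E (kck D) G' \<and> functor_eq E (functor_comp (kck_functor D) G') F
            \<longrightarrow> functor_eq E G' G)"
      by (intro D.kck_universal) (auto intro: boolean_dagger_kernel_category.axioms)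
  qed (rule D.boolean_dagger_kernel_category_kck D.dagger_kernel_morphism_kck_functor
      D.cat_pullback_square_kck classes)+
qed

end
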